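(* There is an absolute constant $C>0$ such that the following holds. Let $p \in (0,1)$, $n \ge 1$, and $f\colon \{0,1\}^n \to \{0,1\}$. Suppose there is an affine function $\ell(x) = c_0 + \sum_{i=1}^n c_i x_i$ (real coefficients) with $\|f-\ell\|_{\mu_p}^2 \le \epsilon$. Then there is a set $S \subseteq [n]$ with $|S| \le \max(1, C\sqrt{\epsilon}/\min(p,1-p))$ such that either $\|f - g\|_{\mu_p}^2 \le C\epsilon$ or $\|(1-f) - g\|_{\mu_p}^2 \le C\epsilon$, where $g(x) = \max_{i\in S} x_i$ if $p \le 1/2$ and $g(x) = \min_{i \in S} x_i$ if $p > 1/2$.
   Context: $\mu_p$ is the product measure on $\{0,1\}^n$ assigning to $x$ the mass $p^{\sum_i x_i}(1-p)^{\sum_i (1-x_i)}$, and $\|h\|_{\mu_p}^2 = \mathbb{E}_{x \sim \mu_p}[h(x)^2]$. By convention $\max_{i\in\emptyset} x_i = 0$ and $\min_{i\in\emptyset} x_i = 1$. *)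

theory Defs
  imports "HOL-Probability.Probability"
begin

(* Points of the cube are extensional on {1..n} (value undefined elsewhere), so that
   cube n has exactly 2^n elements; coordinates are the naturals 0 and 1. *)
definition cube :: "nat \<Rightarrow> (nat \<Rightarrow> nat) set" where
  "cube n = {1..n} \<rightarrow>\<^sub>E {0, 1}"

definition mu :: "real \<Rightarrow> nat \<Rightarrow> (nat \<Rightarrow> nat) measure" where
  "mu p n = point_measure (cube n)
     (\<lambda>x. ennreal (p ^ (\<Sum>i=1..n. x i) * (1 - p) ^ (\<Sum>i=1..n. 1 - x i)))"

definition sqnorm :: "real \<Rightarrow> nat \<Rightarrow> ((nat \<Rightarrow> nat) \<Rightarrow> real) \<Rightarrow> real" where
  "sqnorm p n h = (\<integral>x. (h x)\<^sup>2 \<partial>mu p n)"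

definition max_on :: "nat set \<Rightarrow> (nat \<Rightarrow> nat) \<Rightarrow> nat" where
  "max_on S x = (if S = {} then 0 else Max (x ` S))"

definition min_on :: "nat set \<Rightarrow> (nat \<Rightarrow> nat) \<Rightarrow> nat" where
  "min_on S x = (if S = {} then 1 else Min (x ` S))"

lemma finite_cube: "finite (cube n)"
  by (simp add: cube_def finite_PiE)

lemma sqnorm_eq_sum:
  assumes "0 < p" "p < 1"
  shows "sqnorm p n h =
    (\<Sum>x\<in>cube n. p ^ (\<Sum>i=1..n. x i) * (1 - p) ^ (\<Sum>i=1..n. 1 - x i) * (h x)\<^sup>2)"
  using assms unfolding sqnorm_def mu_def
  by (subst lebesgue_integral_point_measure_finite) (auto simp: finite_cube)

end

(* Identify x with the set T of its ones. A mu_p-random T is a uniformly random subset of a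
   mu_2p-random set J, so the hypothesis passes on average to uniform cubes. On the uniform cube
   over J, split J into A and B and flip the coordinates in A, in B, and in both: four values of
   the affine function form a parallelogram, and a parallelogram with vertices near {0,1} has a
   short side. The sides are Rademacher sums, so for every split one of the two parts carries
   little weight of squared coefficients; hence a single coefficient carries nearly all of it.
   Averaging over J, all coefficients are close to {-1,0,1}, and J rarely meets the set S of
   non-zero rounded coefficients in two or more points, which makes p|S| = O(sqrt eps) as soon as
   |S| > 1. Then T misses S with probability at least 1/2, so the constant term is near 0 or 1;
   replacing f by 1 - f it is near 0, the coefficients near -1 have negligible total mass, and
   the sum over the remaining ones is close to their maximum. *)
theory Submission
  imports Defs
begin


section \<open>Expectations over a \<open>p\<close>-random subset\<close>

definition pexp :: "real \<Rightarrow> 'a set \<Rightarrow> ('a set \<Rightarrow> real) \<Rightarrow> real" where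
  "pexp p N h = (\<Sum>T\<in>Pow N. p ^ card T * (1 - p) ^ card (N - T) * h T)"

lemma pexp_add: "pexp p N (\<lambda>T. g T + h T) = pexp p N g + pexp p N h"
  by (simp add: pexp_def algebra_simps sum.distrib)

lemma pexp_cmult: "pexp p N (\<lambda>T. a * h T) = a * pexp p N h"
  by (simp add: pexp_def sum_distrib_left algebra_simps)

lemma pexp_sum: "pexp p N (\<lambda>T. \<Sum>i\<in>I. h i T) = (\<Sum>i\<in>I. pexp p N (h i))"
  by (simp add: pexp_def sum_distrib_left sum.swap[of _ I])

lemma pexp_mono:
  assumes "0 \<le> p" "p \<le> 1" "\<And>T. T \<subseteq> N \<Longrightarrow> g T \<le> h T"
  shows "pexp p N g \<le> pexp p N h"
  unfolding pexp_def using assms by (intro sum_mono mult_left_mono) auto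

lemma pexp_cong:
  assumes "\<And>T. T \<subseteq> N \<Longrightarrow> g T = h T"
  shows "pexp p N g = pexp p N h"
  unfolding pexp_def using assms by (intro sum.cong) auto

text \<open>The indicator is absorbed into the weights: points of \<open>B\<close> lose the factor
  for lying in \<open>T\<close>, points of \<open>A\<close> the factor for lying outside. The sum
  over \<open>T\<close> is then the expansion of a product of two-term sums.\<close>

lemma pexp_cylinder:
  assumes N: "finite N" and AB: "A \<subseteq> N" "B \<subseteq> N" "A \<inter> B = {}"
  shows "pexp p N (\<lambda>T. of_bool (A \<subseteq> T \<and> T \<inter> B = {})) = p ^ card A * (1 - p) ^ card B"
proof -
  have fin: "finite A" "finite B" using AB N by (auto dest: finite_subset)
  have f: "(\<Prod>i\<in>T. if i \<in> B then 0 else p) = (if T \<inter> B = {} then p ^ card T else 0)"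
    if "T \<subseteq> N" for T
  proof (cases "T \<inter> B = {}")
    case True
    then have "(\<Prod>i\<in>T. if i \<in> B then 0 else p) = (\<Prod>i\<in>T. p)"
      by (intro prod.cong) auto
    then show ?thesis using True by simp
  next
    case False
    moreover have "finite T" using that N finite_subset by auto
    ultimately show ?thesis by auto
  qed
  have g: "(\<Prod>i\<in>N - T. if i \<in> A then 0 else 1 - p) = (if A \<subseteq> T then (1 - p) ^ card (N - T) else 0)"
    for T
  proof (cases "A \<subseteq> T")
    case True
    then have "(\<Prod>i\<in>N - T. if i \<in> A then 0 else 1 - p) = (\<Prod>i\<in>N - T. 1 - p)"
      by (intro prod.cong) auto
    then show ?thesis using True by simp
  next
    case False
    then show ?thesis using N AB by (auto simp: prod_zero_iff)
  qed
  have "pexp p N (\<lambda>T. of_bool (A \<subseteq> T \<and> T \<inter> B = {})) =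
    (\<Sum>T\<in>Pow N. (\<Prod>i\<in>T. if i \<in> B then 0 else p) * (\<Prod>i\<in>N - T. if i \<in> A then 0 else 1 - p))"
    unfolding pexp_def by (intro sum.cong) (auto simp: f g)
  also have "\<dots> = (\<Prod>i\<in>N. (if i \<in> B then 0 else p) + (if i \<in> A then 0 else 1 - p))"
    by (simp add: prod_add[OF N])
  also have "\<dots> = (\<Prod>i\<in>N. (if i \<in> A then p else 1) * (if i \<in> B then 1 - p else 1))"
    using AB by (intro prod.cong) auto
  also have "\<dots> = p ^ card A * (1 - p) ^ card B"
    using AB fin N by (simp add: prod.distrib prod.If_cases Int_absorb1)
  finally show ?thesis .
qed

lemma pexp_const: "finite N \<Longrightarrow> pexp p N (\<lambda>T. a) = a"
  using pexp_cylinder[of N "{}" "{}" p] pexp_cmult[of p N a "\<lambda>T. 1"] by simp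

lemma pexp_mem:
  assumes "finite N" "i \<in> N"
  shows "pexp p N (\<lambda>T. of_bool (i \<in> T)) = p"
  using pexp_cylinder[of N "{i}" "{}" p] assms by simp

lemma pexp_mem2:
  assumes "finite N" "i \<in> N" "j \<in> N" "i \<noteq> j"
  shows "pexp p N (\<lambda>T. of_bool (i \<in> T \<and> j \<in> T)) = p\<^sup>2"
  using pexp_cylinder[of N "{i, j}" "{}" p] assms by (simp add: power2_eq_square)

lemma pexp_inter_empty:
  assumes "finite N" "S \<subseteq> N"
  shows "pexp p N (\<lambda>T. of_bool (T \<inter> S = {})) = (1 - p) ^ card S"
  using pexp_cylinder[of N "{}" S p] assms by simp

lemma sum_eq_sum_of_bool:
  assumes "finite N" "T \<subseteq> N"
  shows "(\<Sum>i\<in>T. c i) = (\<Sum>i\<in>N. c i * of_bool (i \<in> T) :: real)"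
proof -
  have "(\<Sum>i\<in>N. c i * of_bool (i \<in> T)) = (\<Sum>i\<in>N. if i \<in> T then c i else 0)"
    by (intro sum.cong) auto
  then show ?thesis using assms by (simp add: sum.If_cases Int_absorb1)
qed

lemma card_eq_sum_of_bool:
  assumes "finite S"
  shows "real (card (T \<inter> S)) = (\<Sum>i\<in>S. of_bool (i \<in> T))"
proof -
  have "(\<Sum>i\<in>S. of_bool (i \<in> T) :: real) = (\<Sum>i\<in>S. if i \<in> T then 1 else 0)"
    by (intro sum.cong) auto
  then show ?thesis using assms by (simp add: sum.If_cases Int_commute)
qed

lemma pexp_sum_subset:
  assumes "finite N"
  shows "pexp p N (\<lambda>T. \<Sum>i\<in>T. c i) = p * (\<Sum>i\<in>N. c i)"
proof -
  have "pexp p N (\<lambda>T. \<Sum>i\<in>T. c i) = pexp p N (\<lambda>T. \<Sum>i\<in>N. c i * of_bool (i \<in> T))"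
    by (intro pexp_cong sum_eq_sum_of_bool assms)
  also have "\<dots> = (\<Sum>i\<in>N. c i * p)"
    by (simp add: pexp_sum pexp_cmult pexp_mem[OF assms])
  finally show ?thesis by (simp add: sum_distrib_left mult.commute)
qed

lemma pexp_card_Int:
  assumes "finite N" "S \<subseteq> N"
  shows "pexp p N (\<lambda>T. real (card (T \<inter> S))) = p * real (card S)"
proof -
  have "finite S" using assms finite_subset by auto
  then have "pexp p N (\<lambda>T. real (card (T \<inter> S))) = (\<Sum>i\<in>S. pexp p N (\<lambda>T. of_bool (i \<in> T)))"
    by (simp only: card_eq_sum_of_bool pexp_sum)
  also have "\<dots> = (\<Sum>i\<in>S. p)"
    using assms by (intro sum.cong refl pexp_mem) auto
  finally show ?thesis by simp
qed

text \<open>The falling factorial counts ordered pairs of distinct points of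
  \<open>T \<inter> S\<close>, and a given pair lies in \<open>T\<close> with probability
  \<open>p\<^sup>2\<close>.\<close>

lemma pexp_card_Int_falling:
  assumes N: "finite N" and S: "S \<subseteq> N"
  shows "pexp p N (\<lambda>T. real (card (T \<inter> S)) * (real (card (T \<inter> S)) - 1)) =
    p\<^sup>2 * (real (card S) * (real (card S) - 1))"
proof -
  have fS: "finite S" using assms finite_subset by auto
  have "real (card (T \<inter> S)) * (real (card (T \<inter> S)) - 1) =
      (\<Sum>i\<in>S. \<Sum>j\<in>S - {i}. of_bool (i \<in> T \<and> j \<in> T))" for T
  proof -
    have "(\<Sum>i\<in>S. \<Sum>j\<in>S - {i}. of_bool (i \<in> T \<and> j \<in> T)) =
        (\<Sum>i\<in>S. of_bool (i \<in> T) * (real (card (T \<inter> S)) - 1))"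
    proof (rule sum.cong)
      fix i assume "i \<in> S"
      have "real (card (T \<inter> S)) = of_bool (i \<in> T) + (\<Sum>j\<in>S - {i}. of_bool (j \<in> T))"
        unfolding card_eq_sum_of_bool[OF fS] using fS \<open>i \<in> S\<close> by (rule sum.remove)
      then show "(\<Sum>j\<in>S - {i}. of_bool (i \<in> T \<and> j \<in> T)) =
          of_bool (i \<in> T) * (real (card (T \<inter> S)) - 1)"
        by (cases "i \<in> T") auto
    qed simp
    then show ?thesis by (simp add: sum_distrib_right[symmetric] card_eq_sum_of_bool[OF fS])
  qed
  then have "pexp p N (\<lambda>T. real (card (T \<inter> S)) * (real (card (T \<inter> S)) - 1)) =
      (\<Sum>i\<in>S. \<Sum>j\<in>S - {i}. pexp p N (\<lambda>T. of_bool (i \<in> T \<and> j \<in> T)))"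
    by (simp only: pexp_sum)
  also have "\<dots> = (\<Sum>i\<in>S. \<Sum>j\<in>S - {i}. p\<^sup>2)"
    using S by (intro sum.cong refl pexp_mem2[OF N]) auto
  also have "\<dots> = p\<^sup>2 * (real (card S) * (real (card S) - 1))"
  \<comment> \<open>The inner sum has \<open>card S - 1\<close> terms with truncated subtraction,
    which is the real difference only for non-empty \<open>S\<close>.\<close>
  proof (cases "S = {}")
    case False
    then have "card S \<ge> 1" using fS by (simp add: Suc_leI card_gt_0_iff)
    then show ?thesis using fS by (simp add: of_nat_diff)
  qed simp
  finally show ?thesis .
qed

text \<open>Centred membership indicators of distinct points are uncorrelated, so only the diagonal
  of the expanded square survives.\<close>

lemma pexp_variance:
  assumes N: "finite N"
  shows "pexp p N (\<lambda>T. ((\<Sum>i\<in>T. d i) - p * (\<Sum>i\<in>N. d i))\<^sup>2) = p * (1 - p) * (\<Sum>i\<in>N. (d i)\<^sup>2)"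
proof -
  have cov: "pexp p N (\<lambda>T. (of_bool (i \<in> T) - p) * (of_bool (j \<in> T) - p)) =
      (if i = j then p * (1 - p) else 0)" if "i \<in> N" "j \<in> N" for i j
  proof -
    have e: "(of_bool (i \<in> T) - p) * (of_bool (j \<in> T) - p) =
        of_bool (i \<in> T \<and> j \<in> T) + ((- p) * of_bool (i \<in> T) + ((- p) * of_bool (j \<in> T) + p\<^sup>2))" for T
      by (cases "i \<in> T"; cases "j \<in> T") (simp_all add: algebra_simps power2_eq_square)
    show ?thesis
      unfolding e pexp_add pexp_cmult
      using that by (cases "i = j")
        (simp_all add: pexp_mem[OF N] pexp_mem2[OF N] pexp_const[OF N] power2_eq_square algebra_simps)
  qed
  have "pexp p N (\<lambda>T. ((\<Sum>i\<in>T. d i) - p * (\<Sum>i\<in>N. d i))\<^sup>2) =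
      pexp p N (\<lambda>T. \<Sum>i\<in>N. \<Sum>j\<in>N. (d i * d j) * ((of_bool (i \<in> T) - p) * (of_bool (j \<in> T) - p)))"
  proof (rule pexp_cong)
    fix T assume "T \<subseteq> N"
    have *: "(\<Sum>i\<in>T. d i) - p * (\<Sum>i\<in>N. d i) = (\<Sum>i\<in>N. d i * (of_bool (i \<in> T) - p))"
      unfolding sum_eq_sum_of_bool[OF N \<open>T \<subseteq> N\<close>]
      by (simp add: sum_distrib_left algebra_simps sum_subtractf)
    show "((\<Sum>i\<in>T. d i) - p * (\<Sum>i\<in>N. d i))\<^sup>2 =
        (\<Sum>i\<in>N. \<Sum>j\<in>N. (d i * d j) * ((of_bool (i \<in> T) - p) * (of_bool (j \<in> T) - p)))"
      unfolding * power2_eq_square sum_product by (intro sum.cong refl) (simp only: mult_ac)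
  qed
  also have "\<dots> = (\<Sum>i\<in>N. \<Sum>j\<in>N. (d i * d j) * (if i = j then p * (1 - p) else 0))"
    unfolding pexp_sum pexp_cmult by (intro sum.cong refl) (simp add: cov)
  also have "\<dots> = (\<Sum>i\<in>N. d i * d i * (p * (1 - p)))"
    using N by (intro sum.cong refl) (simp add: if_distrib[of "(*) _"] cong: if_cong)
  also have "\<dots> = p * (1 - p) * (\<Sum>i\<in>N. (d i)\<^sup>2)"
    by (simp add: sum_distrib_left power2_eq_square algebra_simps)
  finally show ?thesis .
qed

text \<open>Exchange the two sums: \<open>2 ^ card J\<close> cancels the powers of 2 in
  \<open>(2 * p) ^ card J\<close>, and the total weight of the sets \<open>J\<close> containing a
  given \<open>T\<close> is again a product over points.\<close>

lemma pexp_two_stage: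
  assumes N: "finite N"
  shows "pexp (2 * p) N (\<lambda>J. (\<Sum>T\<in>Pow J. h T) / 2 ^ card J) = pexp p N h"
proof -
  let ?w = "\<lambda>J. p ^ card J * (1 - 2 * p) ^ card (N - J)"
  have w: "(\<Sum>J\<in>Pow N. if T \<subseteq> J then ?w J else 0) = p ^ card T * (1 - p) ^ card (N - T)"
    if T: "T \<subseteq> N" for T
  proof -
    have g: "(\<Prod>i\<in>N - J. if i \<in> T then 0 else 1 - 2 * p) =
        (if T \<subseteq> J then (1 - 2 * p) ^ card (N - J) else 0)" for J
    proof (cases "T \<subseteq> J")
      case True
      then have "(\<Prod>i\<in>N - J. if i \<in> T then 0 else 1 - 2 * p) = (\<Prod>i\<in>N - J. 1 - 2 * p)"
        by (intro prod.cong) auto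
      then show ?thesis using True by simp
    next
      case False
      then show ?thesis using N T by (auto simp: prod_zero_iff)
    qed
    have "(\<Sum>J\<in>Pow N. if T \<subseteq> J then ?w J else 0) =
        (\<Sum>J\<in>Pow N. (\<Prod>i\<in>J. p) * (\<Prod>i\<in>N - J. if i \<in> T then 0 else 1 - 2 * p))"
      by (intro sum.cong refl) (simp add: g)
    \<comment> \<open>A point outside \<open>T\<close> is either in \<open>J\<close> but not chosen,
      with weight \<open>p\<close>, or outside \<open>J\<close>, with weight
      \<open>1 - 2 * p\<close>.\<close>
    also have "\<dots> = (\<Prod>i\<in>N. p + (if i \<in> T then 0 else 1 - 2 * p))"
      by (simp only: prod_add[OF N])
    also have "\<dots> = (\<Prod>i\<in>N. if i \<in> T then p else 1 - p)"
      by (intro prod.cong) auto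
    also have "\<dots> = p ^ card T * (1 - p) ^ card (N - T)"
      using N T by (simp add: prod.If_cases Int_absorb1 Diff_eq)
    finally show ?thesis .
  qed
  have "pexp (2 * p) N (\<lambda>J. (\<Sum>T\<in>Pow J. h T) / 2 ^ card J) = (\<Sum>J\<in>Pow N. ?w J * (\<Sum>T\<in>Pow J. h T))"
    unfolding pexp_def by (intro sum.cong) (auto simp: power_mult_distrib)
  also have "\<dots> = (\<Sum>J\<in>Pow N. \<Sum>T\<in>Pow N. (if T \<subseteq> J then ?w J else 0) * h T)"
  proof (rule sum.cong)
    fix J assume "J \<in> Pow N"
    then have "Pow N \<inter> {T. T \<subseteq> J} = Pow J" by auto
    then have *: "(\<Sum>T\<in>Pow J. h T) = (\<Sum>T\<in>Pow N. if T \<subseteq> J then h T else 0)"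
      using N by (simp add: sum.If_cases)
    show "?w J * (\<Sum>T\<in>Pow J. h T) = (\<Sum>T\<in>Pow N. (if T \<subseteq> J then ?w J else 0) * h T)"
      unfolding * sum_distrib_left by (intro sum.cong) auto
  qed simp
  also have "\<dots> = (\<Sum>T\<in>Pow N. (\<Sum>J\<in>Pow N. if T \<subseteq> J then ?w J else 0) * h T)"
    by (subst sum.swap) (simp only: sum_distrib_right)
  also have "\<dots> = pexp p N h"
    unfolding pexp_def by (intro sum.cong refl) (simp add: w)
  finally show ?thesis .
qed

lemma pexp_complement:
  assumes N: "finite N"
  shows "pexp (1 - p) N (\<lambda>T. h (N - T)) = pexp p N h"
  unfolding pexp_def
  by (rule sum.reindex_bij_witness[of _ "\<lambda>T. N - T" "\<lambda>T. N - T"]) (simp_all add: double_diff mult.commute)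

section \<open>Sums over power sets and Rademacher sums\<close>

lemma sum_Pow_insert:
  fixes h :: "'a set \<Rightarrow> real"
  assumes "finite A" "x \<notin> A"
  shows "(\<Sum>T\<in>Pow (insert x A). h T) = (\<Sum>T\<in>Pow A. h T + h (insert x T))"
proof -
  have "inj_on (insert x) (Pow A)" using assms(2) by (auto intro!: inj_onI)
  moreover have "Pow A \<inter> insert x ` Pow A = {}" using assms(2) by auto
  ultimately show ?thesis
    unfolding Pow_insert using assms(1)
    by (simp add: sum.union_disjoint sum.reindex sum.distrib)
qed

lemma sum_Pow_Un:
  fixes h :: "'a set \<Rightarrow> real"
  assumes "A \<inter> B = {}"
  shows "(\<Sum>S\<in>Pow A. \<Sum>T\<in>Pow B. h (S \<union> T)) = (\<Sum>T\<in>Pow (A \<union> B). h T)"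
  unfolding sum.cartesian_product using assms
  by (intro sum.reindex_bij_witness[of _ "\<lambda>T. (T \<inter> A, T \<inter> B)" "\<lambda>(S, T). S \<union> T"]) auto

lemma sum_Pow_complement:
  fixes h :: "'a set \<Rightarrow> real"
  shows "(\<Sum>T\<in>Pow A. h (A - T)) = (\<Sum>T\<in>Pow A. h T)"
  by (rule sum.reindex_bij_witness[of _ "\<lambda>T. A - T" "\<lambda>T. A - T"]) (auto simp: double_diff)

text \<open>Up to sign, this is the change of an affine function when the part \<open>T\<close> of
  its argument inside \<open>A\<close> is replaced by \<open>A - T\<close>.\<close>

definition rademacher :: "('a \<Rightarrow> real) \<Rightarrow> 'a set \<Rightarrow> 'a set \<Rightarrow> real" where
  "rademacher c A T = (\<Sum>i\<in>A. if i \<in> T then c i else - c i)"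

lemma rademacher_insert:
  assumes "finite A" "x \<notin> A" "T \<subseteq> A"
  shows "rademacher c (insert x A) T = rademacher c A T - c x"
    and "rademacher c (insert x A) (insert x T) = rademacher c A T + c x"
proof -
  have "x \<notin> T" using assms by auto
  then show "rademacher c (insert x A) T = rademacher c A T - c x"
    using assms by (simp add: rademacher_def)
  have "(\<Sum>i\<in>A. if i \<in> insert x T then c i else - c i) = rademacher c A T"
    unfolding rademacher_def using assms by (intro sum.cong) auto
  then show "rademacher c (insert x A) (insert x T) = rademacher c A T + c x"
    using assms by (simp add: rademacher_def)
qed

lemma rademacher_second_moment:
  assumes "finite A"
  shows "(\<Sum>T\<in>Pow A. (rademacher c A T)\<^sup>2) = 2 ^ card A * (\<Sum>i\<in>A. (c i)\<^sup>2)"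
  using assms
proof (induction A rule: finite_induct)
  case empty
  then show ?case by (simp add: rademacher_def)
next
  case (insert x A)
  have "(\<Sum>T\<in>Pow (insert x A). (rademacher c (insert x A) T)\<^sup>2) =
      (\<Sum>T\<in>Pow A. 2 * (rademacher c A T)\<^sup>2 + 2 * (c x)\<^sup>2)"
    unfolding sum_Pow_insert[OF insert(1,2)]
    by (intro sum.cong refl) (simp add: rademacher_insert insert power2_eq_square algebra_simps)
  also have "\<dots> = 2 * (\<Sum>T\<in>Pow A. (rademacher c A T)\<^sup>2) + 2 * (2 ^ card A * (c x)\<^sup>2)"
    using insert(1) by (simp add: sum.distrib sum_distrib_left[symmetric] card_Pow)
  finally show ?case using insert by (simp add: algebra_simps)
qed

text \<open>Induction on \<open>A\<close>: averaging over the sign of the new coefficient removes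
  the odd powers, and the mixed term is given by the second moment.\<close>

lemma rademacher_fourth_moment:
  assumes "finite A"
  shows "(\<Sum>T\<in>Pow A. (rademacher c A T) ^ 4) \<le> 3 * 2 ^ card A * (\<Sum>i\<in>A. (c i)\<^sup>2)\<^sup>2"
  using assms
proof (induction A rule: finite_induct)
  case empty
  then show ?case by (simp add: rademacher_def)
next
  case (insert x A)
  let ?W = "\<Sum>i\<in>A. (c i)\<^sup>2"
  have id: "(a - b) ^ 4 + (a + b) ^ 4 = 2 * a ^ 4 + 12 * b\<^sup>2 * a\<^sup>2 + 2 * b ^ 4" for a b :: real
    by algebra
  have "(\<Sum>T\<in>Pow (insert x A). (rademacher c (insert x A) T) ^ 4) =
      (\<Sum>T\<in>Pow A. 2 * (rademacher c A T) ^ 4 + 12 * (c x)\<^sup>2 * (rademacher c A T)\<^sup>2 + 2 * (c x) ^ 4)"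
    unfolding sum_Pow_insert[OF insert(1,2)]
    by (intro sum.cong refl) (simp add: rademacher_insert insert id)
  also have "\<dots> = 2 * (\<Sum>T\<in>Pow A. (rademacher c A T) ^ 4)
      + 12 * (c x)\<^sup>2 * (\<Sum>T\<in>Pow A. (rademacher c A T)\<^sup>2) + 2 * (2 ^ card A * (c x) ^ 4)"
    using insert(1) by (simp add: sum.distrib sum_distrib_left[symmetric] card_Pow)
  \<comment> \<open>The coefficient 2 of the last term is enlarged to 6 so that the three terms
    complete a square.\<close>
  also have "\<dots> \<le> 2 * (3 * 2 ^ card A * ?W\<^sup>2) + 12 * (c x)\<^sup>2 * (2 ^ card A * ?W)
      + 6 * (2 ^ card A * (c x) ^ 4)"
  proof -
    have "2 ^ card A * (c x) ^ 4 \<ge> 0" by simp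
    then show ?thesis
      using insert.IH unfolding rademacher_second_moment[OF insert(1)] by linarith
  qed
  also have "\<dots> = 3 * 2 ^ card (insert x A) * ((c x)\<^sup>2 + ?W)\<^sup>2"
    using insert(1,2) by (simp add: power2_eq_square power4_eq_xxxx algebra_simps)
  finally show ?case using insert by simp
qed

text \<open>A Paley-Zygmund bound, from \<open>min t 1 \<ge> t - t\<^sup>2 / 4\<close>.\<close>

lemma rademacher_anticoncentration:
  assumes A: "finite A" and W: "(\<Sum>i\<in>A. (c i)\<^sup>2) > 0" (is "?W > 0")
  shows "2 ^ card A / 4 \<le> (\<Sum>T\<in>Pow A. min ((rademacher c A T)\<^sup>2 / ?W) 1)"
proof -
  have le: "t - t\<^sup>2 / 4 \<le> min t 1" for t :: real
    using zero_le_power2[of "t - 2"] by (simp add: power2_eq_square algebra_simps)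
  \<comment> \<open>With \<open>t\<close> the square divided by \<open>?W\<close>, the mean of
    \<open>t\<close> is 1 and that of \<open>t\<^sup>2\<close> is at most 3, which leaves
    \<open>1 - 3/4\<close>.\<close>
  have "2 ^ card A / 4 \<le> 2 ^ card A - (\<Sum>T\<in>Pow A. (rademacher c A T) ^ 4) / (4 * ?W\<^sup>2)"
    using rademacher_fourth_moment[OF A, of c] W by (simp add: field_simps)
  also have "\<dots> = (\<Sum>T\<in>Pow A. (rademacher c A T)\<^sup>2) / ?W
      - (\<Sum>T\<in>Pow A. (rademacher c A T) ^ 4) / (4 * ?W\<^sup>2)"
    using W by (simp add: rademacher_second_moment[OF A])
  also have "\<dots> = (\<Sum>T\<in>Pow A. (rademacher c A T)\<^sup>2 / ?W - ((rademacher c A T)\<^sup>2 / ?W)\<^sup>2 / 4)"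
    unfolding sum_divide_distrib sum_subtractf[symmetric]
    by (intro sum.cong refl) (simp add: power_divide)
  also have "\<dots> \<le> (\<Sum>T\<in>Pow A. min ((rademacher c A T)\<^sup>2 / ?W) 1)"
    by (intro sum_mono le)
  finally show ?thesis .
qed

section \<open>Parallelograms with nearly Boolean vertices\<close>

lemma parallelogram_near_boolean:
  fixes a b c d z1 z2 z3 z4 :: real
  assumes "z1 \<in> {0, 1}" "z2 \<in> {0, 1}" "z3 \<in> {0, 1}" "z4 \<in> {0, 1}" "a + d = b + c"
  shows "min \<bar>b - a\<bar> \<bar>c - a\<bar> \<le> 2 * (\<bar>z1 - a\<bar> + \<bar>z2 - b\<bar> + \<bar>z3 - c\<bar> + \<bar>z4 - d\<bar>)"
    (is "_ \<le> 2 * ?R")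
proof -
  \<comment> \<open>Equal labels at the ends of a side make it short by the triangle inequality.
    Otherwise \<open>z2 = z3\<close> differs from \<open>z1\<close>, so the labels violate the
    parallelogram identity by at least 1; the total error is then at least 1 and absorbs the label
    difference along a side, at the cost of the factor 2.\<close>
  consider "z1 = z2" | "z1 = z3" | "\<bar>z1 + z4 - z2 - z3\<bar> \<ge> 1" using assms by force
  then have "\<bar>b - a\<bar> \<le> 2 * ?R \<or> \<bar>c - a\<bar> \<le> 2 * ?R"
  proof cases
    case 3
    then have 1: "?R \<ge> 1" using assms(5) by linarith
    have 2: "\<bar>b - a\<bar> \<le> 1 + (\<bar>z1 - a\<bar> + \<bar>z2 - b\<bar>)"
    proof -
      have "\<bar>z2 - z1\<bar> \<le> 1" using assms by auto
      then show ?thesis by linarith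
    qed
    have "x \<le> 2 * (p + q + r + s)"
      if "x \<le> 1 + (p + q)" "1 \<le> p + q + r + s" "0 \<le> r" "0 \<le> s" for x p q r s :: real
      using that by (simp only: distrib_left)
    from this[OF 2 1] have "\<bar>b - a\<bar> \<le> 2 * ?R" by simp
    then show ?thesis ..
  next
    case 1
    then have "\<bar>b - a\<bar> \<le> 2 * ?R" by (smt (verit))
    then show ?thesis ..
  next
    case 2
    then have "\<bar>c - a\<bar> \<le> 2 * ?R" by (smt (verit))
    then show ?thesis ..
  qed
  then show ?thesis by (auto simp: min_le_iff_disj)
qed

lemma parallelogram_near_boolean_sq:
  fixes a b c d z1 z2 z3 z4 :: real
  assumes "z1 \<in> {0, 1}" "z2 \<in> {0, 1}" "z3 \<in> {0, 1}" "z4 \<in> {0, 1}" "a + d = b + c"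
  shows "min ((b - a)\<^sup>2) ((c - a)\<^sup>2) \<le> 16 * ((z1 - a)\<^sup>2 + (z2 - b)\<^sup>2 + (z3 - c)\<^sup>2 + (z4 - d)\<^sup>2)"
proof -
  have cs: "(p + q + r + s)\<^sup>2 \<le> 4 * (p\<^sup>2 + q\<^sup>2 + r\<^sup>2 + s\<^sup>2)" for p q r s :: real
  proof -
    have "4 * (p\<^sup>2 + q\<^sup>2 + r\<^sup>2 + s\<^sup>2) - (p + q + r + s)\<^sup>2 =
        (p - q)\<^sup>2 + (p - r)\<^sup>2 + (p - s)\<^sup>2 + (q - r)\<^sup>2 + (q - s)\<^sup>2 + (r - s)\<^sup>2"
      by algebra
    also have "\<dots> \<ge> 0" by (intro add_nonneg_nonneg zero_le_power2)
    finally show ?thesis by simp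
  qed
  have "min ((b - a)\<^sup>2) ((c - a)\<^sup>2) \<le> (min \<bar>b - a\<bar> \<bar>c - a\<bar>)\<^sup>2"
    by (auto simp: min_def)
  also have "\<dots> \<le> (2 * (\<bar>z1 - a\<bar> + \<bar>z2 - b\<bar> + \<bar>z3 - c\<bar> + \<bar>z4 - d\<bar>))\<^sup>2"
    by (intro power_mono parallelogram_near_boolean assms) auto
  \<comment> \<open>The 16 is the squared factor 2 times the 4 of Cauchy-Schwarz for four
    terms.\<close>
  also have "\<dots> \<le> 16 * ((z1 - a)\<^sup>2 + (z2 - b)\<^sup>2 + (z3 - c)\<^sup>2 + (z4 - d)\<^sup>2)"
    using cs[of "\<bar>z1 - a\<bar>" "\<bar>z2 - b\<bar>" "\<bar>z3 - c\<bar>" "\<bar>z4 - d\<bar>"]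
    unfolding power_mult_distrib by simp
  finally show ?thesis .
qed

section \<open>Boolean functions near affine ones on a uniform cube: splits and
  concentration\<close>

lemma sum_Diff_eq_rademacher:
  assumes "finite A" "T \<subseteq> A"
  shows "(\<Sum>i\<in>T. c i) - (\<Sum>i\<in>A - T. c i) = rademacher c A T"
  using assms by (simp add: rademacher_def sum.If_cases Int_absorb1 Diff_eq sum_negf)

text \<open>Turns a minimum into a product, whose sum over independent choices factors. Both
  truncated factors lie in [0, 1], so the product is below each of them.\<close>

lemma min_mult_min_le:
  fixes x y a b :: real
  assumes "x \<ge> 0" "y \<ge> 0" "a > 0" "b > 0"
  shows "min a b * (min (x / a) 1 * min (y / b) 1) \<le> min x y"
proof -
  have xa: "min (x / a) 1 \<ge> 0" and yb: "min (y / b) 1 \<ge> 0" using assms by auto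
  have "min (x / a) 1 * min (y / b) 1 \<le> min (x / a) 1" "min (x / a) 1 * min (y / b) 1 \<le> min (y / b) 1"
    using xa yb by (intro mult_right_le_one_le mult_left_le_one_le; simp)+
  then have 1: "min (x / a) 1 * min (y / b) 1 \<le> x / a" and 2: "min (x / a) 1 * min (y / b) 1 \<le> y / b"
    by linarith+
  have "min a b * (min (x / a) 1 * min (y / b) 1) \<le> a * (x / a)"
    using assms xa yb by (intro mult_mono 1) auto
  moreover have "min a b * (min (x / a) 1 * min (y / b) 1) \<le> b * (y / b)"
    using assms xa yb by (intro mult_mono 2) auto
  ultimately show ?thesis using assms by simp
qed

text \<open>Flipping \<open>S \<union> T\<close> within \<open>A\<close>, within \<open>B\<close>
  and within both gives a parallelogram whose sides are independent Rademacher sums. Their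
  normalised truncated squares each average at least 1/4, so the shorter side is small on average
  only if one of the two weights is small.\<close>

lemma boolean_affine_partition:
  fixes F :: "'a set \<Rightarrow> real"
  assumes A: "finite A" and B: "finite B" and disj: "A \<inter> B = {}"
    and F: "\<And>T. T \<subseteq> A \<union> B \<Longrightarrow> F T \<in> {0, 1}"
  shows "2 ^ card (A \<union> B) * min (\<Sum>i\<in>A. (c i)\<^sup>2) (\<Sum>i\<in>B. (c i)\<^sup>2) \<le>
    1024 * (\<Sum>T\<in>Pow (A \<union> B). (F T - (c0 + (\<Sum>i\<in>T. c i)))\<^sup>2)"
proof -
  let ?WA = "\<Sum>i\<in>A. (c i)\<^sup>2" and ?WB = "\<Sum>i\<in>B. (c i)\<^sup>2"
  let ?E = "\<Sum>T\<in>Pow (A \<union> B). (F T - (c0 + (\<Sum>i\<in>T. c i)))\<^sup>2"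
  have E: "?E \<ge> 0" by (intro sum_nonneg) auto
  show ?thesis
  \<comment> \<open>A zero weight makes the bound trivial; positive weights are needed for the
    normalisation.\<close>
  proof (cases "?WA > 0 \<and> ?WB > 0")
    case False
    moreover have "?WA \<ge> 0" "?WB \<ge> 0" by (intro sum_nonneg; simp)+
    ultimately have "min ?WA ?WB = 0" by (auto simp: min_def)
    then show ?thesis using E by simp
  next
    case True
    then have WA: "?WA > 0" and WB: "?WB > 0" by auto
    define l where "l T = c0 + (\<Sum>i\<in>T. c i)" for T
    define r where "r T = (F T - l T)\<^sup>2" for T
    have l_Un: "l (S \<union> T) = c0 + (\<Sum>i\<in>S. c i) + (\<Sum>i\<in>T. c i)" if "S \<subseteq> A" "T \<subseteq> B" for S T
    proof -
      have "S \<inter> T = {}" "finite S" "finite T" using that disj A B by (auto dest: finite_subset)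
      then show ?thesis by (simp add: l_def sum.union_disjoint)
    qed
    have pt: "min ((rademacher c A S)\<^sup>2) ((rademacher c B T)\<^sup>2) \<le>
        16 * (r (S \<union> T) + r ((A - S) \<union> T) + r (S \<union> (B - T)) + r ((A - S) \<union> (B - T)))"
      if "S \<subseteq> A" "T \<subseteq> B" for S T
    proof -
      have 1: "(l ((A - S) \<union> T) - l (S \<union> T))\<^sup>2 = (rademacher c A S)\<^sup>2"
        using that A by (simp add: l_Un sum_Diff_eq_rademacher[symmetric] power2_commute)
      have 2: "(l (S \<union> (B - T)) - l (S \<union> T))\<^sup>2 = (rademacher c B T)\<^sup>2"
        using that B by (simp add: l_Un sum_Diff_eq_rademacher[symmetric] power2_commute)
      show ?thesis
        unfolding r_def 1[symmetric] 2[symmetric]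
        using that by (intro parallelogram_near_boolean_sq F) (auto simp: l_Un)
    qed
    \<comment> \<open>The 16 collects the factor 1/4 of anticoncentration from each part.\<close>
    have "2 ^ card (A \<union> B) * min ?WA ?WB / 16 = min ?WA ?WB * (2 ^ card A / 4 * (2 ^ card B / 4))"
      using A B disj by (simp add: card_Un_disjoint power_add)
    also have "\<dots> \<le> min ?WA ?WB * ((\<Sum>S\<in>Pow A. min ((rademacher c A S)\<^sup>2 / ?WA) 1) *
        (\<Sum>T\<in>Pow B. min ((rademacher c B T)\<^sup>2 / ?WB) 1))"
      using WA WB
      by (intro mult_left_mono mult_mono rademacher_anticoncentration A B)
         (auto intro!: sum_nonneg)
    also have "\<dots> = (\<Sum>S\<in>Pow A. \<Sum>T\<in>Pow B. min ?WA ?WB *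
        (min ((rademacher c A S)\<^sup>2 / ?WA) 1 * min ((rademacher c B T)\<^sup>2 / ?WB) 1))"
      by (simp only: sum_product) (simp only: sum_distrib_left)
    also have "\<dots> \<le> (\<Sum>S\<in>Pow A. \<Sum>T\<in>Pow B.
        16 * (r (S \<union> T) + r ((A - S) \<union> T) + r (S \<union> (B - T)) + r ((A - S) \<union> (B - T))))"
      using WA WB
      by (intro sum_mono order.trans[OF min_mult_min_le pt]) auto
    \<comment> \<open>Flipping permutes the cube, so each of the four terms sums to the full error.
      In total \<open>16 * 16 * 4 = 1024\<close>.\<close>
    also have "\<dots> = 16 * (4 * (\<Sum>T\<in>Pow (A \<union> B). r T))"
      using sum_Pow_complement[where A = A and h = "\<lambda>S. \<Sum>T\<in>Pow B. r (S \<union> T)"]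
        sum_Pow_complement[where A = A and h = "\<lambda>S. \<Sum>T\<in>Pow B. r (S \<union> (B - T))"]
        sum_Pow_complement[where A = B and h = "\<lambda>T. r (_ \<union> T)"]
      by (simp add: sum.distrib sum_distrib_left[symmetric] sum_Pow_Un[OF disj])
    finally show ?thesis by (simp add: r_def l_def)
  qed
qed

text \<open>If some weight exceeds \<open>K\<close>, splitting off that point shows that the rest is
  light. Otherwise a set grown point by point cannot jump over the range from \<open>K\<close> to
  \<open>2 * K\<close>, so a total above \<open>3 * K\<close> would allow a balanced split.\<close>

lemma concentrated_if_no_balanced_partition:
  fixes w :: "'a \<Rightarrow> real"
  assumes J: "finite J" "J \<noteq> {}" and w: "\<And>i. i \<in> J \<Longrightarrow> w i \<ge> 0" and K: "K \<ge> 0"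
    and part: "\<And>A. A \<subseteq> J \<Longrightarrow> min (\<Sum>i\<in>A. w i) (\<Sum>i\<in>J - A. w i) \<le> K"
  shows "\<exists>j\<in>J. (\<Sum>i\<in>J - {j}. w i) \<le> 3 * K"
proof (cases "\<exists>j\<in>J. w j > K")
  case True
  then obtain j where j: "j \<in> J" "w j > K" by auto
  then have "(\<Sum>i\<in>J - {j}. w i) \<le> K" using part[of "{j}"] by auto
  then show ?thesis using j K by force
next
  case False
  have total: "(\<Sum>i\<in>J. w i) \<le> 3 * K"
  proof (rule ccontr)
    assume big: "\<not> ?thesis"
    \<comment> \<open>One more point on a maximal member of \<open>P\<close> gives weight above
      \<open>K\<close> and at most \<open>2 * K\<close>, leaving more than \<open>K\<close>
      outside.\<close>
    define P where "P = {A \<in> Pow J. (\<Sum>i\<in>A. w i) \<le> K}"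
    have "finite P" unfolding P_def using J by simp
    moreover have "{} \<in> P" unfolding P_def using K by simp
    ultimately obtain A where A: "A \<in> P" and max: "\<And>B. B \<in> P \<Longrightarrow> A \<subseteq> B \<Longrightarrow> A = B"
      using finite_has_maximal2[of P "{}"] by metis
    have AJ: "A \<subseteq> J" and WA: "(\<Sum>i\<in>A. w i) \<le> K"
      using A by (auto simp: P_def)
    then have fA: "finite A" using J finite_subset by blast
    have "A \<noteq> J" using big WA K by auto
    then obtain j where j: "j \<in> J" "j \<notin> A" using AJ by blast
    have ins: "(\<Sum>i\<in>insert j A. w i) = w j + (\<Sum>i\<in>A. w i)" using j fA by simp
    have "insert j A \<notin> P" using max j by blast
    then have "(\<Sum>i\<in>insert j A. w i) > K" using j AJ by (auto simp: P_def)
    moreover have "w j \<le> K" using False j by auto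
    moreover have "(\<Sum>i\<in>J - insert j A. w i) = (\<Sum>i\<in>J. w i) - (\<Sum>i\<in>insert j A. w i)"
      using j AJ J by (intro sum_diff) auto
    ultimately show False using part[of "insert j A"] j AJ big WA ins by (auto simp: min_le_iff_disj)
  qed
  obtain j where "j \<in> J" using J by auto
  then have "(\<Sum>i\<in>J - {j}. w i) \<le> (\<Sum>i\<in>J. w i)" using J w by (intro sum_mono2) auto
  then show ?thesis using \<open>j \<in> J\<close> total by force
qed

section \<open>Rounded coefficients, on a uniform cube and on average\<close>

definition nearest_sign :: "real \<Rightarrow> real" where
  "nearest_sign c = (if \<bar>c\<bar> < 1/2 then 0 else sgn c)"

lemma nearest_sign_values: "nearest_sign c \<in> {-1, 0, 1}"
  by (simp add: nearest_sign_def sgn_if)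

lemma nearest_sign_eq_0_iff: "nearest_sign c = 0 \<longleftrightarrow> \<bar>c\<bar> < 1/2"
  by (auto simp: nearest_sign_def sgn_if)

lemma nearest_sign_optimal:
  assumes "k \<in> {-1, 0, 1}"
  shows "(c - nearest_sign c)\<^sup>2 \<le> (c - k)\<^sup>2"
proof -
  have "\<bar>c - nearest_sign c\<bar> \<le> \<bar>c - k\<bar>"
    using assms by (auto simp: nearest_sign_def sgn_if)
  then show ?thesis by (simp only: abs_le_square_iff)
qed

text \<open>Along an edge in direction \<open>i\<close> the affine function changes by
  \<open>c i\<close> and \<open>F\<close> by -1, 0 or 1, so the rounding error of \<open>c i\<close>
  is at most the difference of the residuals at the two ends. Summing over all edges in that
  direction covers the cube once.\<close>

lemma boolean_affine_coefficient:
  fixes F :: "'a set \<Rightarrow> real"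
  assumes J: "finite J" "i \<in> J" and F: "\<And>T. T \<subseteq> J \<Longrightarrow> F T \<in> {0, 1}"
  shows "2 ^ card J * (c i - nearest_sign (c i))\<^sup>2 \<le>
    4 * (\<Sum>T\<in>Pow J. (F T - (c0 + (\<Sum>i\<in>T. c i)))\<^sup>2)"
proof -
  define r where "r T = F T - (c0 + (\<Sum>i\<in>T. c i))" for T
  let ?b = "(c i - nearest_sign (c i))\<^sup>2"
  let ?A = "J - {i}"
  have A: "finite ?A" "i \<notin> ?A" "insert i ?A = J" using J by auto
  have pt: "?b \<le> 2 * ((r T)\<^sup>2 + (r (insert i T))\<^sup>2)" if T: "T \<subseteq> ?A" for T
  proof -
    have "finite T" "i \<notin> T" using T A finite_subset by blast+
    then have c: "c i - (F (insert i T) - F T) = r T - r (insert i T)" by (simp add: r_def)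
    have "F T \<in> {0, 1}" "F (insert i T) \<in> {0, 1}" using T J F[of T] F[of "insert i T"] by auto
    then have "F (insert i T) - F T \<in> {-1, 0, 1}" by auto
    then have "?b \<le> (r T - r (insert i T))\<^sup>2" using nearest_sign_optimal c by metis
    also have "\<dots> \<le> 2 * ((r T)\<^sup>2 + (r (insert i T))\<^sup>2)"
      using zero_le_power2[of "r T + r (insert i T)"] by (simp add: power2_eq_square algebra_simps)
    finally show ?thesis .
  qed
  have "2 ^ card ?A * ?b = (\<Sum>T\<in>Pow ?A. ?b)" using A by (simp add: card_Pow)
  also have "\<dots> \<le> (\<Sum>T\<in>Pow ?A. 2 * ((r T)\<^sup>2 + (r (insert i T))\<^sup>2))"
    by (intro sum_mono pt) auto
  also have "\<dots> = 2 * (\<Sum>T\<in>Pow J. (r T)\<^sup>2)"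
    using sum_Pow_insert[OF A(1,2)] by (simp only: A(3) sum_distrib_left)
  finally have "2 * (2 ^ card ?A * ?b) \<le> 4 * (\<Sum>T\<in>Pow J. (r T)\<^sup>2)" by simp
  moreover have "card J = Suc (card ?A)" using card_insert_disjoint[OF A(1,2)] A(3) by simp
  ultimately show ?thesis by (simp add: r_def)
qed

text \<open>All squared coefficients but one sum to at most \<open>3 * 1024 * e\<close>, and
  rounding is no worse than replacing by 0; the exceptional coefficient is controlled along edges,
  whence \<open>3076 = 3 * 1024 + 4\<close>. The second left side is the excess of a cardinality
  over one, corrected to 0 for the empty set, in a form whose average over \<open>J\<close> is
  explicit.\<close>

lemma boolean_affine_local:
  fixes F :: "'a set \<Rightarrow> real" and c :: "'a \<Rightarrow> real" and c0 :: real
  assumes J: "finite J" and F: "\<And>T. T \<subseteq> J \<Longrightarrow> F T \<in> {0, 1}"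
  defines "e \<equiv> (\<Sum>T\<in>Pow J. (F T - (c0 + (\<Sum>i\<in>T. c i)))\<^sup>2) / 2 ^ card J"
  shows "(\<Sum>i\<in>J. (c i - nearest_sign (c i))\<^sup>2) \<le> 3076 * e"
    and "real (card {i\<in>J. nearest_sign (c i) \<noteq> 0}) - 1 + of_bool ({i\<in>J. nearest_sign (c i) \<noteq> 0} = {}) \<le> 12288 * e"
proof -
  let ?b = "\<lambda>i. (c i - nearest_sign (c i))\<^sup>2"
  have e: "e \<ge> 0" unfolding e_def by (intro divide_nonneg_nonneg sum_nonneg) auto
  have "(\<Sum>i\<in>J. ?b i) \<le> 3076 * e \<and>
    real (card {i\<in>J. nearest_sign (c i) \<noteq> 0}) - 1 + of_bool ({i\<in>J. nearest_sign (c i) \<noteq> 0} = {}) \<le> 12288 * e"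
  proof (cases "J = {}")
    case True
    then show ?thesis using e by simp
  next
    case False
    have "min (\<Sum>i\<in>A. (c i)\<^sup>2) (\<Sum>i\<in>J - A. (c i)\<^sup>2) \<le> 1024 * e" if "A \<subseteq> J" for A
    proof -
      have U: "A \<union> (J - A) = J" using that by auto
      have "finite A" using that J finite_subset by blast
      then have "2 ^ card J * min (\<Sum>i\<in>A. (c i)\<^sup>2) (\<Sum>i\<in>J - A. (c i)\<^sup>2) \<le>
          1024 * (\<Sum>T\<in>Pow J. (F T - (c0 + (\<Sum>i\<in>T. c i)))\<^sup>2)"
        using boolean_affine_partition[of A "J - A" F c c0, unfolded U] J F by auto
      then show ?thesis by (simp add: e_def field_simps)
    qed
    then obtain j where j: "j \<in> J" and sm: "(\<Sum>i\<in>J - {j}. (c i)\<^sup>2) \<le> 3 * (1024 * e)"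
      using concentrated_if_no_balanced_partition[of J "\<lambda>i. (c i)\<^sup>2" "1024 * e"] J False e by auto
    have "2 ^ card J * ?b j \<le> 4 * (\<Sum>T\<in>Pow J. (F T - (c0 + (\<Sum>i\<in>T. c i)))\<^sup>2)"
      by (rule boolean_affine_coefficient[OF J j F])
    then have "?b j \<le> 4 * e" by (simp add: e_def field_simps)
    moreover have "(\<Sum>i\<in>J - {j}. ?b i) \<le> (\<Sum>i\<in>J - {j}. (c i)\<^sup>2)"
      using nearest_sign_optimal[of 0] by (intro sum_mono) auto
    ultimately have 1: "(\<Sum>i\<in>J. ?b i) \<le> 3076 * e"
      using sm sum.remove[OF J j, of ?b] by simp
    let ?S = "{i\<in>J. nearest_sign (c i) \<noteq> 0}"
    have "real (card ?S) - 1 + of_bool (?S = {}) \<le> 12288 * e"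
    proof (cases "?S = {}")
      case True
      show ?thesis unfolding True using e by simp
    next
      case False
      have "card ?S \<le> card (?S - {j}) + 1"
        using diff_card_le_card_Diff[of "{j}" ?S] by simp
      then have "real (card ?S) - 1 \<le> (\<Sum>i\<in>?S - {j}. 1)" by simp
      also have "\<dots> \<le> (\<Sum>i\<in>?S - {j}. 4 * (c i)\<^sup>2)"
      proof (rule sum_mono)
        fix i assume "i \<in> ?S - {j}"
        \<comment> \<open>Ties are rounded away from 0, so every non-zero rounded coefficient has
          absolute value at least 1/2; this gives \<open>12288 = 4 * 3072\<close>.\<close>
        then have "\<bar>1/2\<bar> \<le> \<bar>c i\<bar>" by (auto simp: nearest_sign_eq_0_iff)
        then have "(1/2)\<^sup>2 \<le> (c i)\<^sup>2" by (simp only: abs_le_square_iff)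
        then show "1 \<le> 4 * (c i)\<^sup>2" by (simp add: power2_eq_square)
      qed
      also have "\<dots> \<le> (\<Sum>i\<in>J - {j}. 4 * (c i)\<^sup>2)" using J by (intro sum_mono2) auto
      also have "\<dots> \<le> 12288 * e" using sm by (simp add: sum_distrib_left[symmetric])
      finally show ?thesis unfolding eq_False[THEN iffD2, OF False] by simp
    qed
    with 1 show ?thesis ..
  qed
  then show "(\<Sum>i\<in>J. ?b i) \<le> 3076 * e"
    "real (card {i\<in>J. nearest_sign (c i) \<noteq> 0}) - 1 + of_bool ({i\<in>J. nearest_sign (c i) \<noteq> 0} = {}) \<le> 12288 * e"
    by auto
qed

text \<open>Average the uniform bounds over a \<open>2 * p\<close>-random \<open>J\<close>: a point
  lies in \<open>J\<close> with probability \<open>2 * p\<close>, and \<open>J\<close> misses a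
  given set of \<open>s\<close> points with probability \<open>(1 - 2 * p) ^ s\<close>.\<close>

lemma boolean_affine_global:
  fixes F :: "'a set \<Rightarrow> real" and c :: "'a \<Rightarrow> real" and c0 :: real
  assumes N: "finite N" and F: "\<And>T. T \<subseteq> N \<Longrightarrow> F T \<in> {0, 1}"
    and p: "0 \<le> p" "p \<le> 1/2"
  defines "e \<equiv> pexp p N (\<lambda>T. (F T - (c0 + (\<Sum>i\<in>T. c i)))\<^sup>2)"
    and "s \<equiv> card {i\<in>N. nearest_sign (c i) \<noteq> 0}"
  shows "2 * p * (\<Sum>i\<in>N. (c i - nearest_sign (c i))\<^sup>2) \<le> 3076 * e"
    and "2 * p * real s - 1 + (1 - 2 * p) ^ s \<le> 12288 * e"
proof -
  define loc where
    "loc J = (\<Sum>T\<in>Pow J. (F T - (c0 + (\<Sum>i\<in>T. c i)))\<^sup>2) / 2 ^ card J" for J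
  have e: "pexp (2 * p) N loc = e" unfolding loc_def e_def by (rule pexp_two_stage[OF N])
  have FJ: "finite J" "\<And>T. T \<subseteq> J \<Longrightarrow> F T \<in> {0, 1}" if "J \<subseteq> N" for J
    using finite_subset[OF that N] F that by auto
  let ?S = "{i\<in>N. nearest_sign (c i) \<noteq> 0}"
  have "2 * p * (\<Sum>i\<in>N. (c i - nearest_sign (c i))\<^sup>2) =
      pexp (2 * p) N (\<lambda>J. \<Sum>i\<in>J. (c i - nearest_sign (c i))\<^sup>2)"
    by (rule pexp_sum_subset[OF N, symmetric])
  also have "\<dots> \<le> pexp (2 * p) N (\<lambda>J. 3076 * loc J)"
    using p unfolding loc_def by (intro pexp_mono boolean_affine_local(1) FJ) auto
  finally show "2 * p * (\<Sum>i\<in>N. (c i - nearest_sign (c i))\<^sup>2) \<le> 3076 * e"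
    by (simp add: pexp_cmult e)
  have "2 * p * real s - 1 + (1 - 2 * p) ^ s =
      pexp (2 * p) N (\<lambda>J. real (card (J \<inter> ?S)) + (- 1 + of_bool (J \<inter> ?S = {})))"
    unfolding pexp_add using N
    by (subst pexp_card_Int, simp, simp, subst pexp_const, simp, subst pexp_inter_empty)
       (simp_all add: s_def)
  also have "\<dots> \<le> pexp (2 * p) N (\<lambda>J. 12288 * loc J)"
  proof (rule pexp_mono)
    fix J assume J: "J \<subseteq> N"
    then have S: "J \<inter> ?S = {i\<in>J. nearest_sign (c i) \<noteq> 0}" by auto
    show "real (card (J \<inter> ?S)) + (- 1 + of_bool (J \<inter> ?S = {})) \<le> 12288 * loc J"
      using boolean_affine_local(2)[where F = F and c = c and ?c0.0 = c0, OF FJ[OF J]]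
      unfolding S loc_def by (simp del: Collect_empty_eq)
  qed (use p in auto)
  finally show "2 * p * real s - 1 + (1 - 2 * p) ^ s \<le> 12288 * e"
    by (simp add: pexp_cmult e)
qed

section \<open>Estimates for powers of \<open>1 - q\<close>\<close>

lemma one_minus_power_upper:
  fixes q :: real
  assumes "0 \<le> q" "q \<le> 1"
  shows "(1 - q) ^ n * (1 + real n * q) \<le> 1"
proof -
  have "(1 - q) ^ n * (1 + real n * q) \<le> (1 - q) ^ n * (1 + q) ^ n"
    using assms Bernoulli_inequality[of q n] by (intro mult_left_mono) auto
  also have "\<dots> = (1 - q\<^sup>2) ^ n"
    by (simp add: power_mult_distrib[symmetric] power2_eq_square algebra_simps)
  also have "\<dots> \<le> 1" using assms by (intro power_le_one) (auto simp: power_le_one)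
  finally show ?thesis .
qed

text \<open>For a binomial count of mean at most \<open>X\<close>, the mean excess over one controls
  the second factorial moment. In the induction the left side grows by
  \<open>2 * n * q\<^sup>2\<close> and the last bracket by \<open>q * (1 - (1 - q) ^ n)\<close>;
  \<open>one_minus_power_upper\<close> compares the two.\<close>

lemma one_minus_power_lower:
  fixes q X :: real
  assumes q: "0 \<le> q" "q \<le> 1" and X: "real n * q \<le> X"
  shows "q\<^sup>2 * (real n * (real n - 1)) \<le> 2 * (1 + X) * (real n * q - 1 + (1 - q) ^ n)"
  using X
proof (induction n)
  case (Suc n)
  have nq: "0 \<le> real n * q" "real n * q \<le> X" using Suc.prems q by (auto simp: algebra_simps)
  have "q * (real n * q) \<le> q * ((1 + X) * (1 - (1 - q) ^ n))"
  proof (intro mult_left_mono q(1))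
    have "(1 - q) ^ n \<le> 1" using q by (intro power_le_one) auto
    have "real n * q \<le> (1 + real n * q) * (1 - (1 - q) ^ n)"
      using one_minus_power_upper[OF q, of n] by (simp add: algebra_simps)
    also have "\<dots> \<le> (1 + X) * (1 - (1 - q) ^ n)"
      using nq \<open>(1 - q) ^ n \<le> 1\<close> by (intro mult_right_mono) auto
    finally show "real n * q \<le> (1 + X) * (1 - (1 - q) ^ n)" .
  qed
  moreover have "q\<^sup>2 * (real n * (real n - 1)) \<le> 2 * (1 + X) * (real n * q - 1 + (1 - q) ^ n)"
    using Suc.IH nq by simp
  ultimately show ?case by (simp add: power2_eq_square algebra_simps)
qed simp

section \<open>From rounded coefficients to a maximum\<close>

lemma power2_sum_le:
  fixes x y :: real
  shows "(x + y)\<^sup>2 \<le> 2 * x\<^sup>2 + 2 * y\<^sup>2"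
  using zero_le_power2[of "x - y"] by (simp add: power2_eq_square algebra_simps)

text \<open>By \<open>Sp\<close>, \<open>T\<close> misses \<open>S\<close> with probability at least
  1/2, which forces \<open>a\<close> to be small; meeting \<open>S\<close> in a single negative
  point is costly, so those points have little mass; and the sum over the positive points differs
  from their maximum only where \<open>T\<close> contains two of them, which \<open>k2\<close>
  bounds.\<close>

lemma near_signed_sum_imp_near_max:
  fixes F :: "'a set \<Rightarrow> real" and \<rho> :: "'a \<Rightarrow> real"
  assumes N: "finite N" and F: "\<And>T. T \<subseteq> N \<Longrightarrow> F T \<in> {0, 1}"
    and p: "0 < p" "p \<le> 1/2"
    and \<rho>: "\<And>i. \<rho> i \<in> {-1, 0, 1}"
    and a: "\<bar>a\<bar> \<le> \<bar>1 - a\<bar>"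
  defines "S \<equiv> {i\<in>N. \<rho> i \<noteq> 0}"
  assumes Sp: "p * real (card S) \<le> 1/2"
    and k2: "p\<^sup>2 * (real (card S) * (real (card S) - 1)) \<le> k2"
    and k1: "pexp p N (\<lambda>T. (F T - (a + (\<Sum>i\<in>T. \<rho> i)))\<^sup>2) \<le> k1"
  shows "\<exists>P\<subseteq>S. pexp p N (\<lambda>T. (F T - of_bool (T \<inter> P \<noteq> {}))\<^sup>2) \<le> 54 * k1 + 6 * k2"
proof -
  define P where "P = {i\<in>N. \<rho> i = 1}"
  define M where "M = {i\<in>N. \<rho> i = -1}"
  have fin: "finite S" "finite P" "finite M" and sub: "S \<subseteq> N" "P \<subseteq> N" "M \<subseteq> N" "P \<subseteq> S" "M \<subseteq> S"
    using N by (auto simp: S_def P_def M_def)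
  have p01: "0 \<le> p" "p \<le> 1" using p by auto
  have \<rho>_sum: "(\<Sum>i\<in>T. \<rho> i) = real (card (T \<inter> P)) - real (card (T \<inter> M))" if "T \<subseteq> N" for T
  proof -
    have fT: "finite T" using that N by (rule finite_subset)
    have "\<rho> i = (if i \<in> P then 1 else 0) - (if i \<in> M then 1 else 0)" if "i \<in> T" for i
      using \<rho>[of i] \<open>T \<subseteq> N\<close> that by (auto simp: P_def M_def)
    then have "(\<Sum>i\<in>T. \<rho> i) = (\<Sum>i\<in>T. (if i \<in> P then 1 else 0) - (if i \<in> M then 1 else 0))"
      by (rule sum.cong[OF refl])
    then show ?thesis using fT by (simp add: sum_subtractf sum.If_cases)
  qed
  have half: "(1 - p) ^ m \<ge> 1/2" if "m \<le> card S" for m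
  proof -
    have "p * real m \<le> p * real (card S)" using that p by (intro mult_left_mono) auto
    then have "1/2 \<le> 1 + real m * - p" using Sp by (simp add: mult.commute)
    also have "\<dots> \<le> (1 + - p) ^ m" using p by (intro Bernoulli_inequality) auto
    finally show ?thesis by simp
  qed
  \<comment> \<open>Where \<open>T\<close> misses \<open>S\<close> the sum vanishes, and the error
    is at least \<open>a\<^sup>2\<close> because \<open>a\<close> is no farther from 0 than from
    1.\<close>
  have "a\<^sup>2 * (1/2) \<le> a\<^sup>2 * (1 - p) ^ card S" by (intro mult_left_mono half) auto
  also have "\<dots> = pexp p N (\<lambda>T. a\<^sup>2 * of_bool (T \<inter> S = {}))"
    by (simp only: pexp_cmult pexp_inter_empty[OF N sub(1)])
  also have "\<dots> \<le> pexp p N (\<lambda>T. (F T - (a + (\<Sum>i\<in>T. \<rho> i)))\<^sup>2)"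
  proof (rule pexp_mono[OF p01])
    fix T assume T: "T \<subseteq> N"
    show "a\<^sup>2 * of_bool (T \<inter> S = {}) \<le> (F T - (a + (\<Sum>i\<in>T. \<rho> i)))\<^sup>2"
    proof (cases "T \<inter> S = {}")
      case True
      then have "(\<Sum>i\<in>T. \<rho> i) = 0" using T by (intro sum.neutral) (auto simp: S_def)
      moreover have "\<bar>a\<bar> \<le> \<bar>F T - a\<bar>" using F[OF T] a by auto
      ultimately show ?thesis by (simp add: abs_le_square_iff)
    qed simp
  qed
  finally have a2: "a\<^sup>2 \<le> 2 * k1" using k1 by simp

  \<comment> \<open>\<open>Q\<close> is the residual without the constant \<open>a\<close>; dropping
    it costs \<open>2 * k1 + 2 * a\<^sup>2\<close>, at most \<open>6 * k1\<close>.\<close>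
  define Q where "Q T = F T - (\<Sum>i\<in>T. \<rho> i)" for T
  have "pexp p N (\<lambda>T. (Q T)\<^sup>2) \<le> pexp p N (\<lambda>T. 2 * (F T - (a + (\<Sum>i\<in>T. \<rho> i)))\<^sup>2 + 2 * a\<^sup>2)"
  proof (rule pexp_mono[OF p01])
    fix T
    have "(Q T)\<^sup>2 = ((F T - (a + (\<Sum>i\<in>T. \<rho> i))) + a)\<^sup>2" by (simp add: Q_def)
    also have "\<dots> \<le> 2 * (F T - (a + (\<Sum>i\<in>T. \<rho> i)))\<^sup>2 + 2 * a\<^sup>2" by (rule power2_sum_le)
    finally show "(Q T)\<^sup>2 \<le> 2 * (F T - (a + (\<Sum>i\<in>T. \<rho> i)))\<^sup>2 + 2 * a\<^sup>2" .
  qed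
  also have "\<dots> \<le> 6 * k1"
    using k1 a2 by (simp add: pexp_add pexp_cmult pexp_const[OF N])
  finally have Q: "pexp p N (\<lambda>T. (Q T)\<^sup>2) \<le> 6 * k1" .

  \<comment> \<open>For \<open>i\<close> in \<open>M\<close> the event
    \<open>T \<inter> S = {i}\<close> has probability at least \<open>p / 2\<close>. These events
    are disjoint, and on them \<open>Q T = F T + 1\<close> is at least 1.\<close>
  have "p * real (card M) * (1/2) = (\<Sum>i\<in>M. p * (1/2))" by simp
  also have "\<dots> \<le> (\<Sum>i\<in>M. p * (1 - p) ^ card (S - {i}))"
    using fin p01 by (intro sum_mono mult_left_mono half card_mono) auto
  also have "\<dots> = (\<Sum>i\<in>M. pexp p N (\<lambda>T. of_bool ({i} \<subseteq> T \<and> T \<inter> (S - {i}) = {})))"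
    using sub by (intro sum.cong refl) (subst pexp_cylinder[OF N], auto)
  also have "\<dots> = pexp p N (\<lambda>T. \<Sum>i\<in>M. of_bool ({i} \<subseteq> T \<and> T \<inter> (S - {i}) = {}))"
    by (rule pexp_sum[symmetric])
  also have "\<dots> \<le> pexp p N (\<lambda>T. (Q T)\<^sup>2)"
  proof (rule pexp_mono[OF p01])
    fix T assume T: "T \<subseteq> N"
    show "(\<Sum>i\<in>M. of_bool ({i} \<subseteq> T \<and> T \<inter> (S - {i}) = {})) \<le> (Q T)\<^sup>2"
    proof (cases "\<exists>i\<in>M. {i} \<subseteq> T \<and> T \<inter> (S - {i}) = {}")
      case True
      then obtain i where i: "i \<in> M" "i \<in> T" "T \<inter> (S - {i}) = {}" by auto
      then have TS: "T \<inter> S = {i}" using sub by auto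
      have "(\<Sum>k\<in>M. of_bool ({k} \<subseteq> T \<and> T \<inter> (S - {k}) = {}) :: real) = (\<Sum>k\<in>M. if k = i then 1 else 0)"
        using TS sub by (intro sum.cong refl) (auto simp: of_bool_def)
      also have "\<dots> = 1" using fin i by simp
      also have "1 \<le> (Q T)\<^sup>2"
      proof -
        have PM: "P \<inter> M = {}" by (auto simp: P_def M_def)
        have "T \<inter> P = {}" "T \<inter> M = {i}" using TS sub i PM by auto
        then have "Q T = F T + 1" by (simp add: Q_def \<rho>_sum[OF T])
        then show ?thesis using F[OF T] by auto
      qed
      finally show ?thesis .
    next
      case False
      then have "(\<Sum>i\<in>M. of_bool ({i} \<subseteq> T \<and> T \<inter> (S - {i}) = {}) :: real) = 0"
        by (intro sum.neutral) auto
      then show ?thesis by simp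
    qed
  qed
  finally have M: "p * real (card M) \<le> 12 * k1" using Q by simp

  have falling: "pexp p N (\<lambda>T. real (card (T \<inter> A)) * (real (card (T \<inter> A)) - 1)) \<le> k2"
    if "A \<subseteq> S" for A
  proof -
    have le: "card A \<le> card S" using that fin by (intro card_mono) auto
    have "real (card A) * (real (card A) - 1) \<le> real (card S) * (real (card S) - 1)"
    \<comment> \<open>For empty \<open>A\<close> the factor \<open>card A - 1\<close> is negative,
      so monotonicity of products does not apply.\<close>
    proof (cases "card A = 0")
      case True
      then show ?thesis by (cases "card S") auto
    qed (use le in \<open>auto intro!: mult_mono\<close>)
    then have "p\<^sup>2 * (real (card A) * (real (card A) - 1)) \<le> k2"
      using k2 by (meson mult_left_mono order_trans zero_le_power2)
    then show ?thesis using that sub pexp_card_Int_falling[OF N, of A p] by auto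
  qed
  \<comment> \<open>The error splits into \<open>Q T\<close>, the count of
    \<open>T \<inter> M\<close>, whose square is its falling factorial plus itself, and the gap
    between the count of \<open>T \<inter> P\<close> and its indicator, whose square is below the
    falling factorial.\<close>
  have "pexp p N (\<lambda>T. (F T - of_bool (T \<inter> P \<noteq> {}))\<^sup>2) \<le>
    pexp p N (\<lambda>T. 3 * ((Q T)\<^sup>2 + (real (card (T \<inter> M)) * (real (card (T \<inter> M)) - 1) +
      (real (card (T \<inter> M)) + real (card (T \<inter> P)) * (real (card (T \<inter> P)) - 1)))))"
  proof (rule pexp_mono[OF p01])
    fix T assume T: "T \<subseteq> N"
    let ?m = "real (card (T \<inter> M))" and ?q = "real (card (T \<inter> P))"
    let ?x = "of_bool (T \<inter> P \<noteq> {}) :: real"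
    have "?q - ?x = 0 \<or> 1 \<le> ?q \<and> ?x = 1"
      using finite_Int[of T P] fin by (cases "T \<inter> P = {}") (auto simp: Suc_le_eq card_gt_0_iff)
    then have qx: "(?q - ?x)\<^sup>2 \<le> ?q * (?q - 1)"
    proof
      assume "?q - ?x = 0"
      then show ?thesis by (cases "card (T \<inter> P)") auto
    qed (auto simp: power2_eq_square intro!: mult_right_mono)
    have sq3: "(x - y + z)\<^sup>2 \<le> 3 * (x\<^sup>2 + (y\<^sup>2 + z\<^sup>2))" for x y z :: real
    proof -
      have "3 * (x\<^sup>2 + (y\<^sup>2 + z\<^sup>2)) - (x - y + z)\<^sup>2 = (x + y)\<^sup>2 + (x - z)\<^sup>2 + (y + z)\<^sup>2" by algebra
      also have "\<dots> \<ge> 0" by (intro add_nonneg_nonneg zero_le_power2)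
      finally show ?thesis by simp
    qed
    have "F T - ?x = Q T - ?m + (?q - ?x)" by (simp add: Q_def \<rho>_sum[OF T])
    then have "(F T - ?x)\<^sup>2 \<le> 3 * ((Q T)\<^sup>2 + (?m\<^sup>2 + (?q - ?x)\<^sup>2))" using sq3 by metis
    also have "\<dots> \<le> 3 * ((Q T)\<^sup>2 + (?m * (?m - 1) + (?m + ?q * (?q - 1))))"
      using qx by (simp add: power2_eq_square algebra_simps)
    finally show "(F T - ?x)\<^sup>2 \<le> 3 * ((Q T)\<^sup>2 + (?m * (?m - 1) + (?m + ?q * (?q - 1))))" .
  qed
  also have "\<dots> \<le> 3 * (6 * k1 + (k2 + (12 * k1 + k2)))"
    unfolding pexp_cmult pexp_add pexp_card_Int[OF N sub(3)]
    by (intro mult_left_mono add_mono Q falling sub M) auto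
  finally show ?thesis using sub(4) by (intro exI[of _ P]) auto
qed

section \<open>The theorem for subsets, \<open>p \<le> 1/2\<close>\<close>

lemma fkn_max_subsets:
  fixes F :: "'a set \<Rightarrow> real" and c :: "'a \<Rightarrow> real" and c0 :: real
  assumes N: "finite N" and F: "\<And>T. T \<subseteq> N \<Longrightarrow> F T \<in> {0, 1}"
    and p: "0 < p" "p \<le> 1/2"
    and e: "pexp p N (\<lambda>T. (F T - (c0 + (\<Sum>i\<in>T. c i)))\<^sup>2) \<le> e"
  shows "\<exists>S\<subseteq>N. real (card S) \<le> max 1 (10^6 * sqrt e / p) \<and>
    (pexp p N (\<lambda>T. (F T - of_bool (T \<inter> S \<noteq> {}))\<^sup>2) \<le> 10^6 * e \<or>
     pexp p N (\<lambda>T. (1 - F T - of_bool (T \<inter> S \<noteq> {}))\<^sup>2) \<le> 10^6 * e)"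
\<comment> \<open>For large \<open>e\<close> the zero function, from the empty set, is near enough.
  Otherwise \<open>12288 * e\<close> is below 1/80.\<close>
proof (cases "1 \<le> 10^6 * e")
  case True
  have "pexp p N (\<lambda>T. (F T - of_bool (T \<inter> {} \<noteq> {}))\<^sup>2) \<le> pexp p N (\<lambda>T. 1)"
  proof (rule pexp_mono)
    show "(F T - of_bool (T \<inter> {} \<noteq> {}))\<^sup>2 \<le> 1" if "T \<subseteq> N" for T using F[OF that] by auto
  qed (use p in auto)
  then show ?thesis using True by (intro exI[of _ "{}"]) (simp add: pexp_const[OF N])
next
  case False
  define \<rho> where "\<rho> i = nearest_sign (c i)" for i
  define \<delta> where "\<delta> i = c i - \<rho> i" for i
  define S where "S = {i\<in>N. \<rho> i \<noteq> 0}"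
  let ?s = "real (card S)"
  let ?x = "?s * (2 * p)"
  have \<rho>: "\<rho> i \<in> {-1, 0, 1}" for i unfolding \<rho>_def by (rule nearest_sign_values)
  have g1: "2 * p * (\<Sum>i\<in>N. (\<delta> i)\<^sup>2) \<le> 3076 * e"
    and g2: "2 * p * ?s - 1 + (1 - 2 * p) ^ card S \<le> 12288 * e"
    using boolean_affine_global[where F = F and p = p and c = c and ?c0.0 = c0, OF N F] p e by (simp_all add: \<delta>_def \<rho>_def S_def)
  \<comment> \<open>The bound on the mean excess becomes a bound on pairs, taking for
    \<open>X\<close> the mean \<open>?x\<close> itself.\<close>
  have g3: "4 * p\<^sup>2 * (?s * (?s - 1)) \<le> 2 * (1 + ?x) * (12288 * e)"
  proof -
    have "(2 * p)\<^sup>2 * (?s * (?s - 1)) \<le> 2 * (1 + ?x) * (?s * (2 * p) - 1 + (1 - 2 * p) ^ card S)"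
      using p by (intro one_minus_power_lower) auto
    also have "\<dots> \<le> 2 * (1 + ?x) * (12288 * e)"
      using p g2 by (intro mult_left_mono) (simp_all add: mult_ac)
    finally show ?thesis by (simp add: power_mult_distrib)
  qed
  have e0: "0 \<le> e"
  proof -
    have "0 = pexp p N (\<lambda>T. 0)" by (simp add: pexp_const[OF N])
    also have "\<dots> \<le> pexp p N (\<lambda>T. (F T - (c0 + (\<Sum>i\<in>T. c i)))\<^sup>2)" using p by (intro pexp_mono) auto
    finally show ?thesis using e by simp
  qed
  have Ssmall: "p * ?s \<le> 1/2 \<and> p\<^sup>2 * (?s * (?s - 1)) \<le> 12288 * e \<and> ?s \<le> max 1 (10^6 * sqrt e / p)"
  \<comment> \<open>With at most one point the falling factorial vanishes, and the 1 in the size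
    bound is what is used.\<close>
  proof (cases "card S \<le> 1")
    case True
    then have "?s = 0 \<or> ?s = 1" by (cases "card S") auto
    then show ?thesis using p e0 by auto
  next
    case False
    then have s2: "?s \<ge> 2" by linarith
    have ss: "?s\<^sup>2 \<le> 2 * (?s * (?s - 1))" using s2 by (simp add: power2_eq_square algebra_simps)
    have x0: "?x > 0" using s2 p by simp
    \<comment> \<open>Bootstrapping: \<open>g3\<close> gives a quadratic inequality for
      \<open>?x\<close> that forces \<open>?x \<le> 1\<close>, after which the factor
      \<open>1 + ?x\<close> in \<open>g3\<close> is at most 2.\<close>
    have "?x\<^sup>2 = 4 * p\<^sup>2 * ?s\<^sup>2" by (simp add: power_mult_distrib)
    also have "\<dots> \<le> 4 * p\<^sup>2 * (2 * (?s * (?s - 1)))" by (intro mult_left_mono ss) auto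
    also have "\<dots> \<le> 4 * (1 + ?x) * (12288 * e)" using g3 by (simp add: algebra_simps)
    also have "\<dots> \<le> 4 * (1 + ?x) * (1 / 80)"
      using x0 \<open>\<not> 1 \<le> 10^6 * e\<close> by (intro mult_left_mono) auto
    finally have x2: "?x\<^sup>2 \<le> (1 + ?x) / 20" by simp
    have "y \<le> 1" if "y\<^sup>2 \<le> (1 + y) / 20" for y :: real
    proof (rule ccontr)
      assume y: "\<not> y \<le> 1"
      then have "y \<le> y\<^sup>2" by (intro self_le_power) auto
      then show False using that y by simp
    qed
    from this[OF x2] have x1: "p * ?s \<le> 1/2" by (simp add: mult_ac)
    have "2 * (1 + ?x) * (12288 * e) \<le> 4 * (12288 * e)"
      using x1 e0 by (intro mult_right_mono) (auto simp: mult_ac)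
    then have fs: "p\<^sup>2 * (?s * (?s - 1)) \<le> 12288 * e" using g3 by (simp add: mult_ac)
    have "(p * ?s)\<^sup>2 \<le> p\<^sup>2 * (2 * (?s * (?s - 1)))"
      unfolding power_mult_distrib by (intro mult_left_mono ss) auto
    also have "\<dots> = 2 * (p\<^sup>2 * (?s * (?s - 1)))" by (simp only: mult_ac)
    also have "\<dots> \<le> 2 * (12288 * e)" by (intro mult_left_mono fs) simp
    also have "\<dots> \<le> (10^6)\<^sup>2 * e" using e0 by simp
    finally have "p * ?s \<le> sqrt ((10^6)\<^sup>2 * e)" using p by (intro real_le_rsqrt) auto
    then have "p * ?s \<le> 10^6 * sqrt e" by (simp add: real_sqrt_mult)
    then have "?s \<le> 10^6 * sqrt e / p" using p by (simp add: field_simps)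
    then show ?thesis using fs x1 by auto
  qed
  \<comment> \<open>The mean of the summed rounding errors is moved into the constant, so that
    rounding costs only their variance; with \<open>g1\<close> this gives
    \<open>3078 = 2 + 3076\<close>.\<close>
  define a where "a = c0 + p * (\<Sum>i\<in>N. \<delta> i)"
  have k1: "pexp p N (\<lambda>T. (F T - (a + (\<Sum>i\<in>T. \<rho> i)))\<^sup>2) \<le> 3078 * e"
  proof -
    have "pexp p N (\<lambda>T. (F T - (a + (\<Sum>i\<in>T. \<rho> i)))\<^sup>2) \<le>
      pexp p N (\<lambda>T. 2 * (F T - (c0 + (\<Sum>i\<in>T. c i)))\<^sup>2 + 2 * ((\<Sum>i\<in>T. \<delta> i) - p * (\<Sum>i\<in>N. \<delta> i))\<^sup>2)"
    proof (rule pexp_mono)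
      fix T
      have "F T - (a + (\<Sum>i\<in>T. \<rho> i)) =
          (F T - (c0 + (\<Sum>i\<in>T. c i))) + ((\<Sum>i\<in>T. \<delta> i) - p * (\<Sum>i\<in>N. \<delta> i))"
        by (simp add: a_def \<delta>_def sum_subtractf)
      then show "(F T - (a + (\<Sum>i\<in>T. \<rho> i)))\<^sup>2 \<le>
          2 * (F T - (c0 + (\<Sum>i\<in>T. c i)))\<^sup>2 + 2 * ((\<Sum>i\<in>T. \<delta> i) - p * (\<Sum>i\<in>N. \<delta> i))\<^sup>2"
        by (simp only: power2_sum_le)
    qed (use p in auto)
    also have "\<dots> \<le> 2 * e + 2 * (p * 1 * (\<Sum>i\<in>N. (\<delta> i)\<^sup>2))"
      unfolding pexp_add pexp_cmult pexp_variance[OF N] using e p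
      by (intro add_mono mult_left_mono mult_right_mono) (auto intro: sum_nonneg)
    also have "\<dots> \<le> 3078 * e" using g1 by simp
    finally show ?thesis .
  qed
  \<comment> \<open>The left coefficient is 239940, so \<open>10^6\<close> leaves room.\<close>
  have const: "54 * (3078 * e) + 6 * (12288 * e) \<le> 10^6 * e" using e0 by simp
  show ?thesis
  proof (cases "\<bar>a\<bar> \<le> \<bar>1 - a\<bar>")
    case True
    have "\<exists>P\<subseteq>S. pexp p N (\<lambda>T. (F T - of_bool (T \<inter> P \<noteq> {}))\<^sup>2) \<le> 54 * (3078 * e) + 6 * (12288 * e)"
      unfolding S_def
      using Ssmall by (intro near_signed_sum_imp_near_max[where a = a] N F p \<rho> True k1) (auto simp: S_def)
    then obtain P where P: "P \<subseteq> S" "pexp p N (\<lambda>T. (F T - of_bool (T \<inter> P \<noteq> {}))\<^sup>2) \<le> 10^6 * e"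
      using const by force
    have "card P \<le> card S" using P N by (intro card_mono) (auto simp: S_def)
    then have "real (card P) \<le> max 1 (10^6 * sqrt e / p)" using Ssmall by linarith
    then show ?thesis using P by (intro exI[of _ P]) (auto simp: S_def)
  next
    case False
    \<comment> \<open>Here \<open>a\<close> is nearer to 1. Passing to \<open>1 - F\<close> turns
      \<open>a\<close> into \<open>1 - a\<close> and \<open>\<rho>\<close> into its negative, with
      the same \<open>S\<close>.\<close>
    have S: "S = {i\<in>N. - \<rho> i \<noteq> 0}" by (simp add: S_def)
    have "(1 - F T - (1 - a + (\<Sum>i\<in>T. - \<rho> i)))\<^sup>2 = (F T - (a + (\<Sum>i\<in>T. \<rho> i)))\<^sup>2" for T
      by (simp add: sum_negf power2_eq_square algebra_simps)
    then have k1': "pexp p N (\<lambda>T. (1 - F T - (1 - a + (\<Sum>i\<in>T. - \<rho> i)))\<^sup>2) \<le> 3078 * e"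
      using k1 by simp
    have "\<exists>P\<subseteq>S. pexp p N (\<lambda>T. ((1 - F T) - of_bool (T \<inter> P \<noteq> {}))\<^sup>2) \<le> 54 * (3078 * e) + 6 * (12288 * e)"
      unfolding S
    proof (rule near_signed_sum_imp_near_max[OF N _ p _ _ _ _ k1'])
      show "1 - F T \<in> {0, 1}" if "T \<subseteq> N" for T using F[OF that] by auto
      show "- \<rho> i \<in> {-1, 0, 1}" for i using \<rho>[of i] by auto
    qed (use False Ssmall in \<open>auto simp: S_def\<close>)
    then obtain P where P: "P \<subseteq> S" "pexp p N (\<lambda>T. (1 - F T - of_bool (T \<inter> P \<noteq> {}))\<^sup>2) \<le> 10^6 * e"
      using const by force
    have "card P \<le> card S" using P N by (intro card_mono) (auto simp: S_def)
    then have "real (card P) \<le> max 1 (10^6 * sqrt e / p)" using Ssmall by linarith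
    then show ?thesis using P by (intro exI[of _ P]) (auto simp: S_def)
  qed
qed

section \<open>Points of the cube, and the range \<open>p \<ge> 1/2\<close>\<close>

definition cube_point :: "nat \<Rightarrow> nat set \<Rightarrow> nat \<Rightarrow> nat" where
  "cube_point n T = (\<lambda>i\<in>{1..n}. of_bool (i \<in> T))"

lemma cube_point_in_cube: "cube_point n T \<in> cube n"
  by (auto simp: cube_point_def cube_def)

lemma sum_cube_point:
  assumes "T \<subseteq> {1..n}"
  shows "(\<Sum>i=1..n. c i * real (cube_point n T i)) = (\<Sum>i\<in>T. c i)"
proof -
  have "(\<Sum>i=1..n. c i * real (cube_point n T i)) = (\<Sum>i=1..n. c i * of_bool (i \<in> T))"
    by (intro sum.cong) (auto simp: cube_point_def)
  also have "\<dots> = (\<Sum>i\<in>T. c i)"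
    using assms by (intro sum_eq_sum_of_bool[symmetric]) auto
  finally show ?thesis .
qed

text \<open>Sets of ones correspond bijectively to points, since \<open>cube_point\<close> is
  undefined off \<open>{1..n}\<close> just as the members of \<open>cube n\<close> are; both
  exponents become cardinalities.\<close>

lemma sqnorm_eq_pexp:
  assumes "0 < p" "p < 1"
  shows "sqnorm p n h = pexp p {1..n} (\<lambda>T. (h (cube_point n T))\<^sup>2)"
  unfolding sqnorm_eq_sum[OF assms] pexp_def
proof (rule sum.reindex_bij_witness[of _ "cube_point n" "\<lambda>x. {i\<in>{1..n}. x i = 1}"])
  fix x assume x: "x \<in> cube n"
  then have x01: "x i = 0 \<or> x i = 1" if "i \<in> {1..n}" for i
    using PiE_mem[OF _ that, of x "\<lambda>_. {0, 1}"] unfolding cube_def by blast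
  show inv: "cube_point n {i\<in>{1..n}. x i = 1} = x"
  proof
    fix i show "cube_point n {i\<in>{1..n}. x i = 1} i = x i"
    proof (cases "i \<in> {1..n}")
      case True
      then show ?thesis using x01[of i] by (auto simp: cube_point_def)
    next
      case False
      then show ?thesis using PiE_arb[OF x[unfolded cube_def] False] False by (auto simp: cube_point_def)
    qed
  qed
  have "(\<Sum>i=1..n. x i) = (\<Sum>i\<in>{1..n}. if x i = 1 then 1 else 0)"
    by (intro sum.cong) (use x01 in auto)
  then have 1: "(\<Sum>i=1..n. x i) = card {i\<in>{1..n}. x i = 1}"
    by (simp add: sum.If_cases Int_def)
  \<comment> \<open>Coordinates are 0 or 1, so truncated subtraction does no harm.\<close>
  have "(\<Sum>i=1..n. 1 - x i) = (\<Sum>i\<in>{1..n}. if x i = 1 then 0 else 1)"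
  proof (rule sum.cong)
    show "1 - x i = (if x i = 1 then 0 else 1)" if "i \<in> {1..n}" for i
      using x01[OF that] by auto
  qed simp
  then have 2: "(\<Sum>i=1..n. 1 - x i) = card ({1..n} - {i\<in>{1..n}. x i = 1})"
    by (simp add: sum.If_cases Diff_eq Int_def cong: conj_cong)
  show "p ^ card {i\<in>{1..n}. x i = 1} * (1 - p) ^ card ({1..n} - {i\<in>{1..n}. x i = 1}) *
      (h (cube_point n {i\<in>{1..n}. x i = 1}))\<^sup>2 =
    p ^ (\<Sum>i=1..n. x i) * (1 - p) ^ (\<Sum>i=1..n. 1 - x i) * (h x)\<^sup>2"
    unfolding inv 1 2 ..
next
  fix T assume T: "T \<in> Pow {1..n}"
  have "cube_point n T i = 1 \<longleftrightarrow> i \<in> T" if "i \<in> {1..n}" for i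
    using that by (simp add: cube_point_def of_bool_def)
  then show "{i\<in>{1..n}. cube_point n T i = 1} = T" using T by blast
  show "cube_point n T \<in> cube n" by (rule cube_point_in_cube)
qed blast

lemma max_on_cube_point:
  assumes "S \<subseteq> {1..n}"
  shows "max_on S (cube_point n T) = of_bool (T \<inter> S \<noteq> {})"
\<comment> \<open>The default 0 over the empty set agrees with the empty intersection.\<close>
proof (cases "S = {}")
  case False
  have im: "cube_point n T ` S = (\<lambda>i. of_bool (i \<in> T)) ` S"
    using assms by (intro image_cong) (auto simp: cube_point_def)
  have "finite S" using assms finite_subset by blast
  then have "Max ((\<lambda>i. of_bool (i \<in> T) :: nat) ` S) = of_bool (T \<inter> S \<noteq> {})"
    using False by (intro Max_eqI) (auto simp: of_bool_def)
  then show ?thesis using False by (simp add: max_on_def im)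
qed (simp add: max_on_def)

lemma min_on_cube_point:
  assumes "S \<subseteq> {1..n}"
  shows "min_on S (cube_point n T) = of_bool (S \<subseteq> T)"
\<comment> \<open>The default 1 over the empty set agrees with
  \<open>{} \<subseteq> T\<close>.\<close>
proof (cases "S = {}")
  case False
  have im: "cube_point n T ` S = (\<lambda>i. of_bool (i \<in> T)) ` S"
    using assms by (intro image_cong) (auto simp: cube_point_def)
  have "finite S" using assms finite_subset by blast
  then have "Min ((\<lambda>i. of_bool (i \<in> T) :: nat) ` S) = of_bool (S \<subseteq> T)"
    using False by (intro Min_eqI) (auto simp: of_bool_def)
  then show ?thesis using False by (simp add: min_on_def im)
qed (simp add: min_on_def)

text \<open>Complementing \<open>T\<close> exchanges \<open>p\<close> with \<open>1 - p\<close>, and maxima with negated minima.\<close>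

lemma fkn_min_subsets:
  fixes F :: "'a set \<Rightarrow> real" and c :: "'a \<Rightarrow> real" and c0 :: real
  assumes N: "finite N" and F: "\<And>T. T \<subseteq> N \<Longrightarrow> F T \<in> {0, 1}"
    and p: "1/2 \<le> p" "p < 1"
    and e: "pexp p N (\<lambda>T. (F T - (c0 + (\<Sum>i\<in>T. c i)))\<^sup>2) \<le> e"
  shows "\<exists>S\<subseteq>N. real (card S) \<le> max 1 (10^6 * sqrt e / (1 - p)) \<and>
    (pexp p N (\<lambda>T. (F T - of_bool (S \<subseteq> T))\<^sup>2) \<le> 10^6 * e \<or>
     pexp p N (\<lambda>T. (1 - F T - of_bool (S \<subseteq> T))\<^sup>2) \<le> 10^6 * e)"
proof -
  have compl: "pexp (1 - p) N g = pexp p N h" if "\<And>T. T \<subseteq> N \<Longrightarrow> g (N - T) = h T" for g h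
  proof -
    have "pexp p N h = pexp p N (\<lambda>T. g (N - T))" by (rule pexp_cong) (simp add: that)
    also have "\<dots> = pexp (1 - p) N g" using pexp_complement[OF N, of "1 - p" g] by simp
    finally show ?thesis by simp
  qed
  \<comment> \<open>In terms of the complement the function stays affine, with the full coefficient
    sum added to the constant and all coefficients negated.\<close>
  have "pexp (1 - p) N (\<lambda>T. (F (N - T) - ((c0 + (\<Sum>i\<in>N. c i)) + (\<Sum>i\<in>T. - c i)))\<^sup>2) =
      pexp p N (\<lambda>T. (F T - (c0 + (\<Sum>i\<in>T. c i)))\<^sup>2)"
  proof (rule compl)
    fix T assume T: "T \<subseteq> N"
    then show "(F (N - (N - T)) - (c0 + (\<Sum>i\<in>N. c i) + (\<Sum>i\<in>N - T. - c i)))\<^sup>2 =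
        (F T - (c0 + (\<Sum>i\<in>T. c i)))\<^sup>2"
      using N by (simp add: double_diff sum_negf sum_diff)
  qed
  then have "\<exists>S\<subseteq>N. real (card S) \<le> max 1 (10^6 * sqrt e / (1 - p)) \<and>
    (pexp (1 - p) N (\<lambda>T. (F (N - T) - of_bool (T \<inter> S \<noteq> {}))\<^sup>2) \<le> 10^6 * e \<or>
     pexp (1 - p) N (\<lambda>T. (1 - F (N - T) - of_bool (T \<inter> S \<noteq> {}))\<^sup>2) \<le> 10^6 * e)"
    using F p e
    by (intro fkn_max_subsets[where ?c0.0 = "c0 + (\<Sum>i\<in>N. c i)" and c = "\<lambda>i. - c i"] N) auto
  then obtain S where S: "S \<subseteq> N" "real (card S) \<le> max 1 (10^6 * sqrt e / (1 - p))"
    and near: "pexp (1 - p) N (\<lambda>T. (F (N - T) - of_bool (T \<inter> S \<noteq> {}))\<^sup>2) \<le> 10^6 * e \<or>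
     pexp (1 - p) N (\<lambda>T. (1 - F (N - T) - of_bool (T \<inter> S \<noteq> {}))\<^sup>2) \<le> 10^6 * e"
    by blast
  \<comment> \<open>A maximum at the complement is 1 minus a minimum, so the two alternatives of the
    conclusion trade places.\<close>
  have ind: "of_bool ((N - T) \<inter> S \<noteq> {}) = 1 - (of_bool (S \<subseteq> T) :: real)" for T
    using S by (auto simp: of_bool_def)
  have "pexp (1 - p) N (\<lambda>T. (F (N - T) - of_bool (T \<inter> S \<noteq> {}))\<^sup>2) =
      pexp p N (\<lambda>T. (1 - F T - of_bool (S \<subseteq> T))\<^sup>2)"
    by (rule compl) (simp add: double_diff ind power2_eq_square algebra_simps del: of_bool_eq)
  moreover have "pexp (1 - p) N (\<lambda>T. (1 - F (N - T) - of_bool (T \<inter> S \<noteq> {}))\<^sup>2) =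
      pexp p N (\<lambda>T. (F T - of_bool (S \<subseteq> T))\<^sup>2)"
    by (rule compl) (simp add: double_diff ind power2_eq_square algebra_simps del: of_bool_eq)
  ultimately show ?thesis using S near by (intro exI[of _ S]) auto
qed

theorem theorem4:
  "\<exists>C::real. C > 0 \<and>
    (\<forall>(p::real) (n::nat) (f::(nat \<Rightarrow> nat) \<Rightarrow> nat) (\<epsilon>::real).
      0 < p \<and> p < 1 \<and> n \<ge> 1 \<and> f \<in> cube n \<rightarrow> {0, 1} \<and>
      (\<exists>(c0::real) (c::nat \<Rightarrow> real).
         sqnorm p n (\<lambda>x. real (f x) - (c0 + (\<Sum>i=1..n. c i * real (x i)))) \<le> \<epsilon>)
      \<longrightarrow>
      (\<exists>S. S \<subseteq> {1..n} \<and>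
         real (card S) \<le> max 1 (C * sqrt \<epsilon> / min p (1 - p)) \<and>
         (let g = (\<lambda>x. real (if p \<le> 1/2 then max_on S x else min_on S x)) in
           sqnorm p n (\<lambda>x. real (f x) - g x) \<le> C * \<epsilon> \<or>
           sqnorm p n (\<lambda>x. (1 - real (f x)) - g x) \<le> C * \<epsilon>)))"
\<comment> \<open>The witness is the constant shared by \<open>fkn_max_subsets\<close> and
  \<open>fkn_min_subsets\<close>.\<close>
proof (intro exI[of _ "10^6"] conjI allI impI)
  fix p :: real and n :: nat and f :: "(nat \<Rightarrow> nat) \<Rightarrow> nat" and \<epsilon> :: real
  assume asm: "0 < p \<and> p < 1 \<and> n \<ge> 1 \<and> f \<in> cube n \<rightarrow> {0, 1} \<and>
      (\<exists>(c0::real) (c::nat \<Rightarrow> real).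
         sqnorm p n (\<lambda>x. real (f x) - (c0 + (\<Sum>i=1..n. c i * real (x i)))) \<le> \<epsilon>)"
  then have p: "0 < p" "p < 1" by auto
  obtain c0 c where
    "sqnorm p n (\<lambda>x. real (f x) - (c0 + (\<Sum>i=1..n. c i * real (x i)))) \<le> \<epsilon>" using asm by auto
  then have "pexp p {1..n} (\<lambda>T. (real (f (cube_point n T)) -
      (c0 + (\<Sum>i=1..n. c i * real (cube_point n T i))))\<^sup>2) \<le> \<epsilon>"
    by (simp only: sqnorm_eq_pexp[OF p])
  also have "pexp p {1..n} (\<lambda>T. (real (f (cube_point n T)) -
      (c0 + (\<Sum>i=1..n. c i * real (cube_point n T i))))\<^sup>2) =
    pexp p {1..n} (\<lambda>T. (real (f (cube_point n T)) - (c0 + (\<Sum>i\<in>T. c i)))\<^sup>2)"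
    by (rule pexp_cong) (simp only: sum_cube_point)
  finally have e: "pexp p {1..n} (\<lambda>T. (real (f (cube_point n T)) - (c0 + (\<Sum>i\<in>T. c i)))\<^sup>2) \<le> \<epsilon>" .
  have F: "real (f (cube_point n T)) \<in> {0, 1}" for T
  proof -
    have "f (cube_point n T) \<in> {0, 1}" using asm cube_point_in_cube by blast
    then show ?thesis by auto
  qed
  show "\<exists>S. S \<subseteq> {1..n} \<and>
         real (card S) \<le> max 1 (10^6 * sqrt \<epsilon> / min p (1 - p)) \<and>
         (let g = (\<lambda>x. real (if p \<le> 1/2 then max_on S x else min_on S x)) in
           sqnorm p n (\<lambda>x. real (f x) - g x) \<le> 10^6 * \<epsilon> \<or>
           sqnorm p n (\<lambda>x. (1 - real (f x)) - g x) \<le> 10^6 * \<epsilon>)"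
  proof (cases "p \<le> 1/2")
    case True
    then have m: "min p (1 - p) = p" by simp
    obtain S where S: "S \<subseteq> {1..n}" and "real (card S) \<le> max 1 (10^6 * sqrt \<epsilon> / p) \<and>
      (pexp p {1..n} (\<lambda>T. (real (f (cube_point n T)) - of_bool (T \<inter> S \<noteq> {}))\<^sup>2) \<le> 10^6 * \<epsilon> \<or>
       pexp p {1..n} (\<lambda>T. (1 - real (f (cube_point n T)) - of_bool (T \<inter> S \<noteq> {}))\<^sup>2) \<le> 10^6 * \<epsilon>)"
      using fkn_max_subsets[OF finite_atLeastAtMost F p(1) True e] by blast
    then show ?thesis
      unfolding sqnorm_eq_pexp[OF p] m Let_def
      by (intro exI[of _ S]) (simp only: True if_True max_on_cube_point[OF S] of_nat_of_bool S simp_thms)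
  next
    case False
    then have m: "min p (1 - p) = 1 - p" and p2: "1/2 \<le> p" by simp_all
    obtain S where S: "S \<subseteq> {1..n}" and "real (card S) \<le> max 1 (10^6 * sqrt \<epsilon> / (1 - p)) \<and>
      (pexp p {1..n} (\<lambda>T. (real (f (cube_point n T)) - of_bool (S \<subseteq> T))\<^sup>2) \<le> 10^6 * \<epsilon> \<or>
       pexp p {1..n} (\<lambda>T. (1 - real (f (cube_point n T)) - of_bool (S \<subseteq> T))\<^sup>2) \<le> 10^6 * \<epsilon>)"
      using fkn_min_subsets[OF finite_atLeastAtMost F p2 p(2) e] by blast
    then show ?thesis
      unfolding sqnorm_eq_pexp[OF p] m Let_def
      by (intro exI[of _ S]) (simp only: False if_False min_on_cube_point[OF S] of_nat_of_bool S simp_thms)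
  qed
qed simp

end
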